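(* Let $k\ge 1$ and let $S=(s_1,\dots,s_k)$ be a finite sequence of symbols $s_i\in\{\uparrow,\downarrow\}$. Then the set $[\mathsf{P}_S,\mathsf{R}]$ of homotopy classes of continuous maps $\mathsf{P}_S\to\mathsf{R}$ is in bijection with the antichains of the partially ordered set $\langle\{1,\dots,k\},\prec\rangle$.
   Context: $\mathsf{R}$ denotes Alexandroff's closed long ray: the set $\omega_1\times[0,1[$ with the topology given by the lexicographic order; its least element is denoted $0$. Homotopy means free homotopy. Let $C=\{(x,y)\in\mathsf{R}^2: y\le x\}$. Indices are read cyclically in $\{1,\dots,k\}$: for a positive integer $i$, $\overline{i}$ is the element of $\{1,\dots,k\}$ congruent to $i$ modulo $k$. The $S$-pipe is the quotient space $\mathsf{P}_S=\left(\bigcup_{i=1}^k C\times\{i\}\right)/\sim$, where $\sim$ is the equivalence relation generated by the following identifications, for all $u\in\mathsf{R}$ and $i\in\{1,\dots,k\}$: - $((u,u),i)\sim((u,0),\overline{i+1})$ if $s_i=s_{\overline{i+1}}=\uparrow$; - $((u,u),i)\sim((u,u),\overline{i+1})$ if $s_i=\uparrow$, $s_{\overline{i+1}}=\downarrow$; - $((u,0),i)\sim((u,0),\overline{i+1})$ if $s_i=\downarrow$, $s_{\overline{i+1}}=\uparrow$; - $((u,0),i)\sim((u,u),\overline{i+1})$ if $s_i=s_{\overline{i+1}}=\downarrow$. The order $\prec$ on $\{1,\dots,k\}$ given by $S$ is defined by: $i\prec j$ iff either $j=\overline{i+\ell}$ for some $1\le\ell\le k$ with $s_{\overline{i}}=\cdots=s_{\overline{i+\ell-1}}=\uparrow$,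 or $i=\overline{j+\ell}$ for some $1\le\ell\le k$ with $s_{\overline{j}}=\cdots=s_{\overline{j+\ell-1}}=\downarrow$ (in other words, if one can pass from $i$ to $j$ following arrows). It is possible that $i\prec i$, if all $s_j$ are equal. An antichain in a partially ordered set is a set of pairwise incomparable elements; the empty antichain is included.
   Formalization: If all s_i are equal, ≺ is not a partial order on {1,…,k} and the literal claim fails for k ≥ 2 (two homotopy classes, but k+1 antichains, or one); here elements with i≺j≺i are identified, giving a one-point poset. Otherwise nothing changes. *)

theory Defs
  imports "HOL-Analysis.Analysis" "HOL-Number_Theory.Cong"
begin

section \<open>The closed long ray\<close>

text \<open>The cardinal successor of \<^term>\<open>natLeq\<close> is a well-order of type $\omega_1$.\<close>

typedef omega1 = "Field (cardSuc natLeq)"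
  using Field_cardSuc_not_empty[OF natLeq_Card_order] by blast

instantiation omega1 :: wellorder
begin

definition less_eq_omega1 :: "omega1 \<Rightarrow> omega1 \<Rightarrow> bool" where
  "a \<le> b \<longleftrightarrow> (Rep_omega1 a, Rep_omega1 b) \<in> cardSuc natLeq"

definition less_omega1 :: "omega1 \<Rightarrow> omega1 \<Rightarrow> bool" where
  "a < b \<longleftrightarrow> a \<le> b \<and> a \<noteq> (b :: omega1)"

instance
proof -
  have wo: "Well_order (cardSuc natLeq)"
    by (rule cardSuc_Well_order[OF natLeq_Card_order])
  then have refl: "refl_on (Field (cardSuc natLeq)) (cardSuc natLeq)"
    and tr: "trans (cardSuc natLeq)" and as: "antisym (cardSuc natLeq)"
    and tot: "Total (cardSuc natLeq)" and wf: "wf (cardSuc natLeq - Id)"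
    by (auto simp: well_order_on_def linear_order_on_def partial_order_on_def preorder_on_def)
  have le_refl: "x \<le> x" for x :: omega1
    using refl Rep_omega1[of x] by (auto simp: less_eq_omega1_def refl_on_def)
  have antis: "x = y" if "x \<le> y" "y \<le> x" for x y :: omega1
    using that antisymD[OF as] by (auto simp: less_eq_omega1_def simp flip: Rep_omega1_inject)
  have lin: "x \<le> y \<or> y \<le> x" for x y :: omega1
  proof (cases "x = y")
    case True
    then show ?thesis using le_refl by simp
  next
    case False
    then have "Rep_omega1 x \<noteq> Rep_omega1 y"
      by (simp add: Rep_omega1_inject)
    then show ?thesis
      using tot Rep_omega1[of x] Rep_omega1[of y]
      by (auto simp: less_eq_omega1_def total_on_def)
  qed
  have eq: "{(x, y). x < y} = inv_image (cardSuc natLeq - Id) Rep_omega1"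
    by (auto simp: less_omega1_def less_eq_omega1_def inv_image_def Rep_omega1_inject)
  have wfl: "wf {(x :: omega1, y). x < y}"
    unfolding eq by (rule wf_inv_image[OF wf])
  show "OFCLASS(omega1, wellorder_class)"
  proof
    fix x y z :: omega1
    show "x < y \<longleftrightarrow> x \<le> y \<and> \<not> y \<le> x"
      using antis le_refl by (auto simp: less_omega1_def)
    show "x \<le> x" by (rule le_refl)
    show "x \<le> y \<Longrightarrow> y \<le> z \<Longrightarrow> x \<le> z"
      using tr by (auto simp: less_eq_omega1_def trans_def)
    show "x \<le> y \<Longrightarrow> y \<le> x \<Longrightarrow> x = y" by (rule antis)
    show "x \<le> y \<or> y \<le> x" by (rule lin)
  next
    fix P :: "omega1 \<Rightarrow> bool" and a
    assume "\<And>x. (\<And>y. y < x \<Longrightarrow> P y) \<Longrightarrow> P x"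
    then show "P a"
      using wf_induct[OF wfl, of P a] by blast
  qed
qed

end

lemma omega1_uncountable:
  includes cardinal_syntax
  shows "uncountable (UNIV :: omega1 set)"
proof
  assume "countable (UNIV :: omega1 set)"
  then have "countable (Rep_omega1 ` UNIV)"
    by (rule countable_image)
  then have c: "countable (Field (cardSuc natLeq))"
    using type_definition.Rep_range[OF type_definition_omega1] by simp
  have "|Field (cardSuc natLeq)| \<le>o |UNIV :: nat set|"
    using c by (auto simp: countable_def card_of_ordLeq[symmetric])
  moreover have "|Field (cardSuc natLeq)| =o cardSuc natLeq"
    using cardSuc_Card_order[OF natLeq_Card_order] card_of_Field_ordIso by blast
  moreover have "|UNIV :: nat set| =o natLeq"
    by (rule card_of_nat)
  ultimately have "cardSuc natLeq \<le>o natLeq"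
    using ordIso_ordLeq_trans ordIso_symmetric ordLeq_ordIso_trans by blast
  then show False
    using cardSuc_greater[OF natLeq_Card_order] not_ordLess_ordLeq by blast
qed

lemma omega1_countable_lessThan:
  includes cardinal_syntax
  shows "countable {..<a :: omega1}"
proof -
  let ?r = "cardSuc natLeq"
  have co: "Card_order ?r" by (rule cardSuc_Card_order[OF natLeq_Card_order])
  have "|underS ?r (Rep_omega1 a)| <o ?r"
    using card_of_underS[OF co] Rep_omega1[of a] by blast
  then have "|underS ?r (Rep_omega1 a)| \<le>o natLeq"
    using cardSuc_ordLess_ordLeq[OF natLeq_Card_order, of "|underS ?r (Rep_omega1 a)|"]
      cardSuc_ordLeq_ordLess[OF natLeq_Card_order, of "|underS ?r (Rep_omega1 a)|"]
      card_of_Card_order by blast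
  then have "|underS ?r (Rep_omega1 a)| \<le>o |UNIV :: nat set|"
    using card_of_nat ordIso_symmetric ordLeq_ordIso_trans by blast
  then have "countable (underS ?r (Rep_omega1 a))"
    by (auto simp: countable_def card_of_ordLeq[symmetric])
  moreover have "Rep_omega1 ` {..<a} \<subseteq> underS ?r (Rep_omega1 a)"
    by (auto simp: underS_def less_omega1_def less_eq_omega1_def Rep_omega1_inject)
  ultimately have "countable (Rep_omega1 ` {..<a})"
    using countable_subset by blast
  then show ?thesis
    by (rule countable_image_inj_on) (auto simp: inj_on_def Rep_omega1_inject)
qed

typedef long_ray = "UNIV \<times> {0..<1} :: (omega1 \<times> real) set"
  by auto

instantiation long_ray :: linorder
begin

definition less_eq_long_ray :: "long_ray \<Rightarrow> long_ray \<Rightarrow> bool" where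
  "x \<le> y \<longleftrightarrow> fst (Rep_long_ray x) < fst (Rep_long_ray y) \<or>
     fst (Rep_long_ray x) = fst (Rep_long_ray y) \<and> snd (Rep_long_ray x) \<le> snd (Rep_long_ray y)"

definition less_long_ray :: "long_ray \<Rightarrow> long_ray \<Rightarrow> bool" where
  "x < y \<longleftrightarrow> x \<le> y \<and> x \<noteq> (y :: long_ray)"

instance
proof
  fix x y z :: long_ray
  have antis: "x = y" if "x \<le> y" "y \<le> x" for x y :: long_ray
    using that by (auto simp: less_eq_long_ray_def Rep_long_ray_inject[symmetric] prod_eq_iff)
  show "x < y \<longleftrightarrow> x \<le> y \<and> \<not> y \<le> x"
    using antis[of x y] by (auto simp: less_long_ray_def less_eq_long_ray_def)
  show "x \<le> x" by (simp add: less_eq_long_ray_def)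
  show "x \<le> y \<Longrightarrow> y \<le> z \<Longrightarrow> x \<le> z"
    by (auto simp: less_eq_long_ray_def)
  show "x \<le> y \<Longrightarrow> y \<le> x \<Longrightarrow> x = y" by (rule antis)
  show "x \<le> y \<or> y \<le> x"
    by (auto simp: less_eq_long_ray_def)
qed

end

instantiation long_ray :: linorder_topology
begin

definition open_long_ray :: "long_ray set \<Rightarrow> bool" where
  "open_long_ray = generate_topology (range (\<lambda>a. {..<a}) \<union> range (\<lambda>a. {a<..}))"

instance
  by standard (rule open_long_ray_def)

end

instantiation long_ray :: zero
begin

definition zero_long_ray :: long_ray where
  "0 = Abs_long_ray (LEAST a. True, 0)"

instance ..

end

lemma long_ray_zero_le: "0 \<le> (x :: long_ray)"
proof -
  have "(LEAST a. True) \<le> fst (Rep_long_ray x)"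
    by (rule Least_le) simp
  moreover have "0 \<le> snd (Rep_long_ray x)"
    using Rep_long_ray[of x] by (auto simp: mem_Times_iff)
  ultimately show ?thesis
    by (auto simp: zero_long_ray_def less_eq_long_ray_def Abs_long_ray_inverse)
qed


section \<open>Quotient spaces and homotopy classes\<close>

definition generated_equiv :: "'a set \<Rightarrow> ('a \<times> 'a) set \<Rightarrow> ('a \<times> 'a) set" where
  "generated_equiv A G = \<Inter>{E. equiv A E \<and> G \<subseteq> E}"

lemma equiv_generated_equiv:
  assumes "G \<subseteq> A \<times> A"
  shows "equiv A (generated_equiv A G)"
proof -
  have top: "equiv A (A \<times> A)"
    by (auto simp: equiv_def refl_on_def sym_def trans_def)
  have sub: "generated_equiv A G \<subseteq> A \<times> A"
    using top assms by (auto simp: generated_equiv_def)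
  show ?thesis
  proof (rule equivI)
    show "generated_equiv A G \<subseteq> A \<times> A" by (rule sub)
    show "refl_on A (generated_equiv A G)"
      using sub by (auto simp: refl_on_def generated_equiv_def equiv_def)
    show "sym (generated_equiv A G)"
      unfolding sym_def generated_equiv_def by (auto simp: equiv_def dest: symD)
    show "trans (generated_equiv A G)"
      unfolding trans_def generated_equiv_def by (auto simp: equiv_def dest: transD)
  qed
qed

definition quotient_topology :: "'a topology \<Rightarrow> ('a \<times> 'a) set \<Rightarrow> 'a set topology" where
  "quotient_topology X E = topology (\<lambda>U. U \<subseteq> topspace X // E \<and> openin X (\<Union>U))"

lemma openin_quotient_topology:
  assumes "equiv (topspace X) E"
  shows "openin (quotient_topology X E) U \<longleftrightarrow> U \<subseteq> topspace X // E \<and> openin X (\<Union>U)"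
proof -
  have Int_eq: "\<Union>(U \<inter> V) = \<Union>U \<inter> \<Union>V"
    if "U \<subseteq> topspace X // E" "V \<subseteq> topspace X // E" for U V
    using that quotient_disj[OF assms] by blast
  have "istopology (\<lambda>U. U \<subseteq> topspace X // E \<and> openin X (\<Union>U))"
    unfolding istopology_def
  proof (intro conjI allI impI)
    fix U V
    assume "U \<subseteq> topspace X // E \<and> openin X (\<Union>U)" "V \<subseteq> topspace X // E \<and> openin X (\<Union>V)"
    then show "U \<inter> V \<subseteq> topspace X // E" "openin X (\<Union>(U \<inter> V))"
      by (auto simp: Int_eq)
  next
    fix K
    assume K: "\<forall>U\<in>K. U \<subseteq> topspace X // E \<and> openin X (\<Union>U)"
    then show "\<Union>K \<subseteq> topspace X // E" by blast
    have "\<Union>(\<Union>K) = \<Union>(Union ` K)" by blast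
    moreover have "openin X (\<Union>(Union ` K))"
      using K by (intro openin_Union) auto
    ultimately show "openin X (\<Union>(\<Union>K))" by simp
  qed
  then show ?thesis
    by (simp add: quotient_topology_def topology_inverse')
qed

lemma topspace_quotient_topology:
  assumes "equiv (topspace X) E"
  shows "topspace (quotient_topology X E) = topspace X // E"
proof -
  have "openin (quotient_topology X E) (topspace X // E)"
    by (simp add: openin_quotient_topology[OF assms] Union_quotient[OF assms])
  then show ?thesis
    using openin_quotient_topology[OF assms] openin_subset
    by (metis openin_topspace subset_antisym)
qed

lemma quotient_map_quotient_topology:
  assumes "equiv (topspace X) E"
  shows "quotient_map X (quotient_topology X E) (\<lambda>x. E `` {x})"
  unfolding quotient_map_def
proof (intro conjI allI impI)
  show "(\<lambda>x. E `` {x}) ` topspace X = topspace (quotient_topology X E)"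
    unfolding topspace_quotient_topology[OF assms] by (auto simp: quotient_def)
next
  fix U
  assume U: "U \<subseteq> topspace (quotient_topology X E)"
  then have U': "U \<subseteq> topspace X // E"
    by (simp add: topspace_quotient_topology[OF assms])
  have "{x \<in> topspace X. E `` {x} \<in> U} = \<Union>U"
  proof (intro set_eqI iffI)
    fix x
    assume "x \<in> {x \<in> topspace X. E `` {x} \<in> U}"
    then show "x \<in> \<Union>U"
      using equiv_class_self[OF assms] by blast
  next
    fix x
    assume "x \<in> \<Union>U"
    then obtain c where c: "c \<in> U" "x \<in> c" by blast
    with U' obtain y where y: "y \<in> topspace X" "c = E `` {y}"
      by (auto simp: quotient_def)
    with c have "(y, x) \<in> E" by auto
    then have "E `` {x} = c" "x \<in> topspace X"
      using y equiv_class_eq[OF assms] assms by (auto simp: equiv_def refl_on_def)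
    with c show "x \<in> {x \<in> topspace X. E `` {x} \<in> U}" by auto
  qed
  then show "openin X {x \<in> topspace X. E `` {x} \<in> U} = openin (quotient_topology X E) U"
    using U' by (simp add: openin_quotient_topology[OF assms])
qed

text \<open>Free homotopy. Maps that agree on the space \<open>X\<close> are homotopic whatever their values outside \<open>X\<close>, so these
  classes correspond to the classes of maps that are only defined on \<open>X\<close>.\<close>

definition homotopy_classes :: "'a topology \<Rightarrow> 'b topology \<Rightarrow> ('a \<Rightarrow> 'b) set set" where
  "homotopy_classes X Y =
     {f. continuous_map X Y f} // {(f, g). homotopic_with (\<lambda>_. True) X Y f g}"

lemma equiv_homotopic:
  "equiv {f. continuous_map X Y f} {(f, g). homotopic_with (\<lambda>_. True) X Y f g}"
  by (rule equivI)
    (auto simp: refl_on_def sym_def trans_def homotopic_with_sym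
      dest: homotopic_with_imp_continuous_maps intro: homotopic_with_trans)

lemma homotopic_if_eq_on_space:
  assumes "continuous_map X Y f" "\<And>x. x \<in> topspace X \<Longrightarrow> f x = g x"
  shows "homotopic_with (\<lambda>_. True) X Y f g"
  by (rule homotopic_with_equal) (use assms continuous_map_eq in auto)


section \<open>The pipe\<close>

datatype arrow = Up | Down

definition wrap :: "nat \<Rightarrow> nat \<Rightarrow> nat" where
  "wrap k i = (i - 1) mod k + 1"

lemma wrap_in_range: "k \<ge> 1 \<Longrightarrow> wrap k i \<in> {1..k}"
  by (simp add: wrap_def Suc_leI)

lemma wrap_cong:
  assumes "i \<ge> 1"
  shows "wrap k i mod k = i mod k"
proof -
  have "wrap k i mod k = (i - 1 + 1) mod k"
    unfolding wrap_def by (rule mod_add_left_eq)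
  then show ?thesis using assms by simp
qed

definition arr :: "arrow list \<Rightarrow> nat \<Rightarrow> arrow" where
  "arr S i = S ! (wrap (length S) i - 1)"

definition octant :: "(long_ray \<times> long_ray) set" where
  "octant = {(x, y). y \<le> x}"

definition octants :: "nat \<Rightarrow> ((long_ray \<times> long_ray) \<times> nat) topology" where
  "octants k = prod_topology (top_of_set octant) (discrete_topology {1..k})"

inductive_set pipe_gluing ::
  "arrow list \<Rightarrow> (((long_ray \<times> long_ray) \<times> nat) \<times> ((long_ray \<times> long_ray) \<times> nat)) set"
  for S :: "arrow list" where
  UpUp: "i \<in> {1..length S} \<Longrightarrow> arr S i = Up \<Longrightarrow> arr S (i + 1) = Up \<Longrightarrow>
    (((u, u), i), ((u, 0), wrap (length S) (i + 1))) \<in> pipe_gluing S"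
| UpDown: "i \<in> {1..length S} \<Longrightarrow> arr S i = Up \<Longrightarrow> arr S (i + 1) = Down \<Longrightarrow>
    (((u, u), i), ((u, u), wrap (length S) (i + 1))) \<in> pipe_gluing S"
| DownUp: "i \<in> {1..length S} \<Longrightarrow> arr S i = Down \<Longrightarrow> arr S (i + 1) = Up \<Longrightarrow>
    (((u, 0), i), ((u, 0), wrap (length S) (i + 1))) \<in> pipe_gluing S"
| DownDown: "i \<in> {1..length S} \<Longrightarrow> arr S i = Down \<Longrightarrow> arr S (i + 1) = Down \<Longrightarrow>
    (((u, 0), i), ((u, u), wrap (length S) (i + 1))) \<in> pipe_gluing S"

definition pipe_equiv ::
  "arrow list \<Rightarrow> (((long_ray \<times> long_ray) \<times> nat) \<times> ((long_ray \<times> long_ray) \<times> nat)) set" where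
  "pipe_equiv S = generated_equiv (octant \<times> {1..length S}) (pipe_gluing S)"

definition pipe :: "arrow list \<Rightarrow> ((long_ray \<times> long_ray) \<times> nat) set topology" where
  "pipe S = quotient_topology (octants (length S)) (pipe_equiv S)"

lemma topspace_octants: "topspace (octants k) = octant \<times> {1..k}"
  by (simp add: octants_def)

lemma pipe_gluing_subset:
  "pipe_gluing S \<subseteq> (octant \<times> {1..length S}) \<times> (octant \<times> {1..length S})"
proof (rule subrelI)
  fix p q
  assume pq: "(p, q) \<in> pipe_gluing S"
  obtain a b i c d j where eq: "p = ((a, b), i)" "q = ((c, d), j)"
    by (metis surj_pair)
  from pq show "(p, q) \<in> (octant \<times> {1..length S}) \<times> (octant \<times> {1..length S})"
    unfolding eq
    by (cases rule: pipe_gluing.cases)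
      (use wrap_in_range[of "length S" "i + 1"] in \<open>auto simp: octant_def long_ray_zero_le\<close>)
qed

lemma equiv_pipe_equiv: "equiv (topspace (octants (length S))) (pipe_equiv S)"
  unfolding topspace_octants pipe_equiv_def
  by (rule equiv_generated_equiv[OF pipe_gluing_subset])

lemma quotient_map_pipe: "quotient_map (octants (length S)) (pipe S) (\<lambda>p. pipe_equiv S `` {p})"
  unfolding pipe_def by (rule quotient_map_quotient_topology[OF equiv_pipe_equiv])


section \<open>The order given by the arrows\<close>

definition arrow_less :: "arrow list \<Rightarrow> nat \<Rightarrow> nat \<Rightarrow> bool" where
  "arrow_less S i j \<longleftrightarrow>
     (\<exists>l\<in>{1..length S}. j = wrap (length S) (i + l) \<and> (\<forall>m<l. arr S (i + m) = Up)) \<or>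
     (\<exists>l\<in>{1..length S}. i = wrap (length S) (j + l) \<and> (\<forall>m<l. arr S (j + m) = Down))"

definition antichains :: "'a set \<Rightarrow> ('a \<times> 'a) set \<Rightarrow> 'a set set" where
  "antichains A r = {B. B \<subseteq> A \<and> pairwise (\<lambda>x y. (x, y) \<notin> r \<and> (y, x) \<notin> r) B}"

text \<open>If all arrows are equal, then \<open>i \<prec> j\<close> for all \<open>i\<close> and \<open>j\<close>, and \<open>\<prec>\<close> is only a preorder.
  As usual, the partially ordered set given by a preorder is its set of classes of elements that
  precede each other. Otherwise \<open>\<prec>\<close> is a strict partial order and all classes are singletons,
  see \<open>arrow_less_strict_order\<close> and \<open>antichains_arrow_poset\<close> below.\<close>

definition arrow_equiv :: "arrow list \<Rightarrow> (nat \<times> nat) set" where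
  "arrow_equiv S = {(i, j). i \<in> {1..length S} \<and> j \<in> {1..length S} \<and>
     (i = j \<or> arrow_less S i j \<and> arrow_less S j i)}"

definition arrow_poset :: "arrow list \<Rightarrow> nat set set" where
  "arrow_poset S = {1..length S} // arrow_equiv S"

definition arrow_poset_less :: "arrow list \<Rightarrow> (nat set \<times> nat set) set" where
  "arrow_poset_less S = {(X, Y). X \<in> arrow_poset S \<and> Y \<in> arrow_poset S \<and> X \<noteq> Y \<and>
     (\<exists>i\<in>X. \<exists>j\<in>Y. arrow_less S i j)}"

lemma wrap_id: "i \<in> {1..k} \<Longrightarrow> wrap k i = i"
  by (auto simp: wrap_def)

lemma wrap_add:
  assumes "i \<ge> 1"
  shows "wrap k (wrap k i + m) = wrap k (i + m)"
  using assms by (simp add: wrap_def mod_add_left_eq)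

lemma wrap_eq_iff:
  assumes "i \<ge> 1" "j \<ge> 1"
  shows "wrap k i = wrap k j \<longleftrightarrow> i mod k = j mod k"
proof
  assume "wrap k i = wrap k j"
  then show "i mod k = j mod k" using wrap_cong assms by metis
next
  assume "i mod k = j mod k"
  then have "(i - 1 + 1) mod k = (j - 1 + 1) mod k" using assms by simp
  then have "(i - 1) mod k = (j - 1) mod k"
    using cong_add_rcancel_nat[of "i - 1" 1 "j - 1" k] by (simp add: cong_def)
  then show "wrap k i = wrap k j" by (simp add: wrap_def)
qed

lemma arr_cong: "wrap (length S) i = wrap (length S) j \<Longrightarrow> arr S i = arr S j"
  by (simp add: arr_def)

lemma arr_wrap_add: "i \<ge> 1 \<Longrightarrow> arr S (wrap (length S) i + m) = arr S (i + m)"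
  by (rule arr_cong) (rule wrap_add)

lemma wrap_surj:
  assumes "i \<ge> 1" "n \<in> {1..k}"
  shows "\<exists>m<k. wrap k (i + m) = n"
proof -
  have "\<exists>m<k. wrap k (wrap k i + m) = n"
  proof -
    have r: "wrap k i \<in> {1..k}" using assms by (intro wrap_in_range) auto
    show ?thesis
    proof (cases "wrap k i \<le> n")
      case True
      then show ?thesis using r assms wrap_id[of n k]
        by (intro exI[of _ "n - wrap k i"]) auto
    next
      case False
      have "wrap k (n + k) = wrap k n" using assms by (subst wrap_eq_iff) auto
      then have "wrap k (n + k) = n" using wrap_id[OF assms(2)] by simp
      then show ?thesis using False r assms
        by (intro exI[of _ "n + k - wrap k i"]) auto
    qed
  qed
  then show ?thesis using wrap_add[OF assms(1)] by simp
qed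

lemma arr_all:
  assumes "i \<ge> 1" "\<forall>m<length S. arr S (i + m) = a"
  shows "set S \<subseteq> {a}"
proof
  fix b
  assume "b \<in> set S"
  then obtain n where n: "n < length S" "b = S ! n" by (auto simp: in_set_conv_nth)
  obtain m where "m < length S" "wrap (length S) (i + m) = n + 1"
    using wrap_surj[OF assms(1), of "n + 1" "length S"] n by auto
  then show "b \<in> {a}" using assms(2) n by (auto simp: arr_def)
qed

text \<open>One of the two disjuncts in the definition of \<open>\<prec>\<close>.\<close>

definition reaches :: "arrow list \<Rightarrow> arrow \<Rightarrow> nat \<Rightarrow> nat \<Rightarrow> bool" where
  "reaches S a i j \<longleftrightarrow>
     (\<exists>l\<in>{1..length S}. j = wrap (length S) (i + l) \<and> (\<forall>m<l. arr S (i + m) = a))"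

lemma arrow_less_iff: "arrow_less S i j \<longleftrightarrow> reaches S Up i j \<or> reaches S Down j i"
  by (simp add: arrow_less_def reaches_def)

lemma reaches_trans:
  assumes "i \<ge> 1" "reaches S a i j" "reaches S a j n" "\<not> set S \<subseteq> {a}"
  shows "reaches S a i n"
proof -
  let ?k = "length S"
  obtain l where l: "l \<in> {1..?k}" "j = wrap ?k (i + l)" "\<forall>m<l. arr S (i + m) = a"
    using assms(2) unfolding reaches_def by blast
  obtain l' where l': "l' \<in> {1..?k}" "n = wrap ?k (j + l')" "\<forall>m<l'. arr S (j + m) = a"
    using assms(3) unfolding reaches_def by blast
  have "arr S (i + l + m) = a" if "m < l'" for m
    using l' that arr_wrap_add[of "i + l" S m] l assms by auto
  then have all: "arr S (i + m) = a" if "m < l + l'" for m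
    using that l(3) \<open>\<And>m. m < l' \<Longrightarrow> arr S (i + l + m) = a\<close>[of "m - l"]
    by (cases "m < l") auto
  then have "l + l' < ?k" using arr_all[of i S a] assms by fastforce
  moreover have "n = wrap ?k (i + (l + l'))"
    using l' l wrap_add[of "i + l" ?k l'] assms by (simp add: add.assoc)
  ultimately show ?thesis using l l' all by (auto simp: reaches_def)
qed

lemma reaches_irrefl:
  assumes "i \<in> {1..length S}" "reaches S a i i"
  shows "set S \<subseteq> {a}"
proof -
  let ?k = "length S"
  obtain l where l: "l \<in> {1..?k}" "i = wrap ?k (i + l)" "\<forall>m<l. arr S (i + m) = a"
    using assms(2) unfolding reaches_def by blast
  have "wrap ?k (i + l) = wrap ?k i" using l wrap_id assms by metis
  then have "(i + l) mod ?k = i mod ?k" using wrap_eq_iff[of "i + l" i] assms by auto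
  then have "?k dvd l" using cong_add_lcancel_0_nat[of i l ?k] by (auto simp: cong_def)
  then have "l = ?k" using l by (auto dest: dvd_imp_le)
  then show ?thesis using l(3) assms(1) by (intro arr_all[of i S a]) auto
qed

lemma reaches_mixed_start: "reaches S Up i j \<Longrightarrow> reaches S Down i n \<Longrightarrow> False"
  unfolding reaches_def by (fastforce dest: spec[of _ 0])

lemma reaches_mixed_end:
  assumes "i \<ge> 1" "n \<ge> 1" "reaches S Up i j" "reaches S Down n j"
  shows False
proof -
  let ?k = "length S"
  obtain l where l: "l \<in> {1..?k}" "j = wrap ?k (i + l)" "\<forall>m<l. arr S (i + m) = Up"
    using assms(3) unfolding reaches_def by blast
  obtain l' where l': "l' \<in> {1..?k}" "j = wrap ?k (n + l')" "\<forall>m<l'. arr S (n + m) = Down"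
    using assms(4) unfolding reaches_def by blast
  have "(i + (l - 1) + 1) mod ?k = (n + (l' - 1) + 1) mod ?k"
    using l l' wrap_eq_iff[of "i + l" "n + l'" ?k] assms by auto
  then have "(i + (l - 1)) mod ?k = (n + (l' - 1)) mod ?k"
    using cong_add_rcancel_nat[of "i + (l - 1)" 1 "n + (l' - 1)" ?k] by (simp add: cong_def)
  then have "arr S (i + (l - 1)) = arr S (n + (l' - 1))"
    using wrap_eq_iff[of "i + (l - 1)" "n + (l' - 1)" ?k] assms by (intro arr_cong) auto
  moreover have "arr S (i + (l - 1)) = Up" "arr S (n + (l' - 1)) = Down"
    using l(1) l(3)[rule_format, of "l - 1"] l'(1) l'(3)[rule_format, of "l' - 1"] by simp_all
  ultimately show False by simp
qed

lemma arrow_less_strict_order: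
  assumes "Up \<in> set S" "Down \<in> set S"
  shows "i \<in> {1..length S} \<Longrightarrow> \<not> arrow_less S i i"
    and "\<lbrakk>i \<in> {1..length S}; j \<in> {1..length S}; n \<in> {1..length S};
          arrow_less S i j; arrow_less S j n\<rbrakk> \<Longrightarrow> arrow_less S i n"
proof -
  have nc: "\<not> set S \<subseteq> {a}" for a
    using assms by (cases a) auto
  show "\<not> arrow_less S i i" if "i \<in> {1..length S}"
    using reaches_irrefl[OF that] nc by (auto simp: arrow_less_iff)
  assume "i \<in> {1..length S}" "j \<in> {1..length S}" "n \<in> {1..length S}"
    "arrow_less S i j" "arrow_less S j n"
  then show "arrow_less S i n"
    using reaches_trans[OF _ _ _ nc] reaches_mixed_start reaches_mixed_end
    unfolding arrow_less_iff by (metis atLeastAtMost_iff)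
qed

lemma arrow_less_if_constant:
  assumes "set S \<subseteq> {a}" "i \<in> {1..length S}" "j \<in> {1..length S}"
  shows "arrow_less S i j"
proof -
  let ?k = "length S"
  have a: "arr S m = a" for m
  proof -
    have "wrap ?k m - 1 < ?k"
      using wrap_in_range[of ?k m] assms by auto
    then show ?thesis using assms(1) nth_mem unfolding arr_def by blast
  qed
  have "reaches S a p q" if p: "p \<in> {1..?k}" and q: "q \<in> {1..?k}" for p q
  proof -
    obtain m where "m < ?k" "wrap ?k (p + 1 + m) = q"
      using wrap_surj[OF _ q, of "p + 1"] by auto
    then show ?thesis using a unfolding reaches_def
      by (intro bexI[of _ "m + 1"]) (auto simp: add_ac)
  qed
  then show ?thesis using assms by (cases a) (auto simp: arrow_less_iff)
qed

lemma arrow_equiv_nonconstant: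
  assumes "Up \<in> set S" "Down \<in> set S"
  shows "arrow_equiv S = Id_on {1..length S}"
  using arrow_less_strict_order[OF assms] unfolding arrow_equiv_def by blast

lemma arrow_equiv_constant:
  assumes "set S \<subseteq> {a}"
  shows "arrow_equiv S = {1..length S} \<times> {1..length S}"
  using arrow_less_if_constant[OF assms] unfolding arrow_equiv_def by blast

lemma equiv_arrow_equiv: "equiv {1..length S} (arrow_equiv S)"
proof (cases "Up \<in> set S \<and> Down \<in> set S")
  case True
  then show ?thesis
    by (auto simp: arrow_equiv_nonconstant equiv_def refl_on_def sym_def trans_def)
next
  case False
  then obtain a where "set S \<subseteq> {a}"
    by (metis (full_types) arrow.exhaust singleton_iff subsetI)
  then show ?thesis
    by (auto simp: arrow_equiv_constant equiv_def refl_on_def sym_def trans_def)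
qed

lemma arrow_poset_constant:
  assumes "set S \<subseteq> {a}" "S \<noteq> []"
  shows "arrow_poset S = {{1..length S}}"
proof -
  have "{1..length S} \<noteq> {}"
    using assms(2) by (cases S) auto
  then show ?thesis
    by (auto simp: arrow_poset_def arrow_equiv_constant[OF assms(1)] quotient_def)
qed

lemma antichains_arrow_poset:
  assumes "Up \<in> set S" "Down \<in> set S"
  shows "bij_betw (image (\<lambda>i. {i}))
           (antichains {1..length S} {(i, j). arrow_less S i j})
           (antichains (arrow_poset S) (arrow_poset_less S))"
proof -
  let ?s = "\<lambda>i :: nat. {i}"
  have poset: "arrow_poset S = ?s ` {1..length S}"
    by (auto simp: arrow_poset_def arrow_equiv_nonconstant[OF assms] quotient_def)
  have less: "({i}, {j}) \<in> arrow_poset_less S \<longleftrightarrow> i \<noteq> j \<and> arrow_less S i j"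
    if "i \<in> {1..length S}" "j \<in> {1..length S}" for i j
    using that by (auto simp: arrow_poset_less_def poset)
  have iff: "?s ` B \<in> antichains (arrow_poset S) (arrow_poset_less S) \<longleftrightarrow>
      B \<in> antichains {1..length S} {(i, j). arrow_less S i j}" if B: "B \<subseteq> {1..length S}" for B
  proof -
    have "({i}, {j}) \<in> arrow_poset_less S \<longleftrightarrow> i \<noteq> j \<and> arrow_less S i j"
      if "i \<in> B" "j \<in> B" for i j
      using less that B by blast
    then show ?thesis
      using B by (auto simp: antichains_def pairwise_def poset simp del: atLeastAtMost_iff)
  qed
  have "C \<in> image ?s ` antichains {1..length S} {(i, j). arrow_less S i j}"
    if C: "C \<in> antichains (arrow_poset S) (arrow_poset_less S)" for C
  proof -
    obtain B where B: "B \<subseteq> {1..length S}" "C = ?s ` B"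
      using C by (auto simp: antichains_def poset subset_image_iff)
    with C iff show ?thesis by blast
  qed
  moreover have "inj (image ?s)"
    by (rule inj_onI) (metis (no_types) inj_image_eq_iff inj_on_def singleton_inject)
  moreover have "?s ` B \<in> antichains (arrow_poset S) (arrow_poset_less S)"
    if "B \<in> antichains {1..length S} {(i, j). arrow_less S i j}" for B
    using that iff by (auto simp: antichains_def)
  ultimately show ?thesis
    unfolding bij_betw_def by (auto intro: inj_on_subset)
qed

end

theory Submission
  imports Defs
begin

text \<open>A map is classified by the set of seams of the pipe on which it is unbounded. An interleaving
  argument on \<open>\<omega>\<^sub>1\<close> shows that a map on an octant that is unbounded on the horizontal side is
  unbounded on the diagonal, so this set is closed under following the arrows; it is invariant under
  homotopy because the unit interval is connected and separable. Conversely, on each octant a map has the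
  same growth as \<open>x\<close>, \<open>y\<close> or \<open>0\<close>, depending on the unbounded sides, and two maps of the same growth are
  homotopic: there are cofinally many points of the ray that never separate their values, and between
  consecutive such points one can interpolate linearly. Closed sets of seams correspond to antichains via
  their minimal elements.\<close>

subsection \<open>The long ray as a linear continuum\<close>

text \<open>The ray has no continuous injection into the reals, so homotopies cannot be written down
  by linear interpolation in one chart; only initial segments embed. What is used instead is that
  countable subsets of the ray are bounded. Countably many conditions that can each be met by pairs
  of arbitrarily large points can then be met in turn along one increasing sequence, and its
  supremum \<open>a\<close> gives one pair \<open>(a, a)\<close> in the closure of all of them.
  Nearly every growth statement is a choice of such conditions: the graph of an unbounded map forces
  \<open>a\<close> to be a fixed point, while a closed set where the map stays below some
  \<open>b < a\<close> forbids it. So an unbounded map cannot oscillate, which is why boundedness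
  alone can be a complete invariant. Growth passes from the horizontal side to the diagonal because
  all horizontal lines share it and the higher ones enter the region where both coordinates are
  large, which the diagonal governs; the coordinate \<open>y\<close> shows that it does not pass
  back.\<close>

lemma snd_Rep_long_ray: "0 \<le> snd (Rep_long_ray x)" "snd (Rep_long_ray x) < 1"
  using Rep_long_ray[of x] by (auto simp: mem_Times_iff)

lemma Rep_Abs_long_ray [simp]: "0 \<le> r \<Longrightarrow> r < 1 \<Longrightarrow> Rep_long_ray (Abs_long_ray (a, r)) = (a, r)"
  by (simp add: Abs_long_ray_inverse)

lemma less_long_ray_iff:
  "x < y \<longleftrightarrow> fst (Rep_long_ray x) < fst (Rep_long_ray y) \<or>
     fst (Rep_long_ray x) = fst (Rep_long_ray y) \<and> snd (Rep_long_ray x) < snd (Rep_long_ray y)"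
  by (auto simp: less_long_ray_def less_eq_long_ray_def Rep_long_ray_inject[symmetric] prod_eq_iff)

instantiation long_ray :: conditionally_complete_linorder
begin

text \<open>The infimum is taken in the block of the least ordinal that occurs. Blocks are closed on
  the left, so it stays there, whereas a supremum may jump to the next block; hence
  \<open>Sup\<close> is reduced to \<open>Inf\<close>.\<close>

definition Inf_long_ray :: "long_ray set \<Rightarrow> long_ray" where
  "Inf X = (let a = (LEAST a. a \<in> fst ` Rep_long_ray ` X)
            in Abs_long_ray (a, Inf {r. (a, r) \<in> Rep_long_ray ` X}))"

definition Sup_long_ray :: "long_ray set \<Rightarrow> long_ray" where
  "Sup X = Inf {b :: long_ray. \<forall>x\<in>X. x \<le> b}"

definition inf_long_ray :: "long_ray \<Rightarrow> long_ray \<Rightarrow> long_ray" where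
  "inf_long_ray = min"

definition sup_long_ray :: "long_ray \<Rightarrow> long_ray \<Rightarrow> long_ray" where
  "sup_long_ray = max"

instance
proof
  have Inf_props: "\<exists>a A. (\<forall>x\<in>X. a \<le> fst (Rep_long_ray x)) \<and> A = {r. (a, r) \<in> Rep_long_ray ` X} \<and>
      A \<noteq> {} \<and> bdd_below A \<and> Rep_long_ray (Inf X) = (a, Inf A)"
    if X: "X \<noteq> {}" for X :: "long_ray set"
  proof -
    define a where "a = (LEAST a. a \<in> fst ` Rep_long_ray ` X)"
    define A where "A = {r. (a, r) \<in> Rep_long_ray ` X}"
    have "a \<in> fst ` Rep_long_ray ` X"
      unfolding a_def by (rule LeastI_ex) (use X in auto)
    then have ne: "A \<noteq> {}" by (auto simp: A_def) (metis imageI prod.collapse)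
    have le: "\<forall>x\<in>X. a \<le> fst (Rep_long_ray x)"
      unfolding a_def by (auto intro: Least_le)
    have rng: "0 \<le> r \<and> r < 1" if "r \<in> A" for r
      using that snd_Rep_long_ray by (auto simp: A_def) (metis snd_conv)+
    then have bdd: "bdd_below A" by (auto simp: bdd_below_def)
    obtain r where r: "r \<in> A" using ne by auto
    have "0 \<le> Inf A" using rng ne by (intro cInf_greatest) auto
    moreover have "Inf A < 1"
      using cInf_lower[OF r bdd] rng[OF r] by simp
    ultimately have "Rep_long_ray (Inf X) = (a, Inf A)"
      by (simp add: Inf_long_ray_def Let_def flip: a_def A_def)
    then show ?thesis using le ne bdd A_def by blast
  qed
  show "inf x y \<le> x" "inf x y \<le> y" "z \<le> x \<Longrightarrow> z \<le> y \<Longrightarrow> z \<le> inf x y"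
    "x \<le> sup x y" "y \<le> sup x y" "x \<le> z \<Longrightarrow> y \<le> z \<Longrightarrow> sup x y \<le> z" for x y z :: long_ray
    by (simp_all add: inf_long_ray_def sup_long_ray_def)
  show lower: "Inf X \<le> x" if x: "x \<in> X" for x :: long_ray and X
  proof -
    obtain a A where a: "\<forall>x\<in>X. a \<le> fst (Rep_long_ray x)" "A = {r. (a, r) \<in> Rep_long_ray ` X}"
      "bdd_below A" "Rep_long_ray (Inf X) = (a, Inf A)"
      using Inf_props[of X] x by blast
    show ?thesis
    proof (cases "a = fst (Rep_long_ray x)")
      case True
      then have "snd (Rep_long_ray x) \<in> A" using a x by (auto intro!: image_eqI[of _ _ x])
      then have "Inf A \<le> snd (Rep_long_ray x)" using a(3) by (rule cInf_lower)
      then show ?thesis using True a(4) by (simp add: less_eq_long_ray_def)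
    next
      case False
      then show ?thesis using a x by (auto simp: less_eq_long_ray_def order.not_eq_order_implies_strict)
    qed
  qed
  show greatest: "z \<le> Inf X" if X: "X \<noteq> {}" and z: "\<And>x. x \<in> X \<Longrightarrow> z \<le> x" for z :: long_ray and X
  proof -
    obtain a A where a: "\<forall>x\<in>X. a \<le> fst (Rep_long_ray x)" "A = {r. (a, r) \<in> Rep_long_ray ` X}"
      "A \<noteq> {}" "Rep_long_ray (Inf X) = (a, Inf A)"
      using Inf_props[OF X] by blast
    have *: "fst (Rep_long_ray z) < a \<or> fst (Rep_long_ray z) = a \<and> snd (Rep_long_ray z) \<le> r"
      if r: "r \<in> A" for r
    proof -
      obtain x where x: "x \<in> X" "Rep_long_ray x = (a, r)" using r a(2) by (auto elim!: imageE dest: sym)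
      then show ?thesis using z[OF x(1)] by (simp add: less_eq_long_ray_def)
    qed
    show ?thesis
    proof (cases "fst (Rep_long_ray z) < a")
      case False
      then have "fst (Rep_long_ray z) = a" "\<And>r. r \<in> A \<Longrightarrow> snd (Rep_long_ray z) \<le> r"
        using * a(3) by blast+
      moreover from this(2) have "snd (Rep_long_ray z) \<le> Inf A"
        by (rule cInf_greatest[OF a(3)])
      ultimately show ?thesis using a(4) by (simp add: less_eq_long_ray_def)
    qed (simp add: less_eq_long_ray_def a)
  qed
  show "x \<le> Sup X" if "x \<in> X" "bdd_above X" for x :: long_ray and X
    unfolding Sup_long_ray_def by (rule greatest) (use that in \<open>auto simp: bdd_above_def\<close>)
  show "Sup X \<le> z" if "X \<noteq> {}" "\<And>x. x \<in> X \<Longrightarrow> x \<le> z" for z :: long_ray and X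
    unfolding Sup_long_ray_def by (rule lower) (use that in auto)
qed

end

text \<open>A countable union of countable initial segments cannot exhaust \<open>omega1\<close>;
  the block of any missing ordinal lies above \<open>A\<close>.\<close>

lemma long_ray_gt_countable:
  assumes "countable A"
  shows "\<exists>b :: long_ray. \<forall>a\<in>A. a < b"
proof -
  have "countable (\<Union>a\<in>A. {..fst (Rep_long_ray a)})"
    using assms omega1_countable_lessThan
    by (intro countable_UN) (auto simp: ivl_disj_un_singleton(2)[symmetric])
  then have "(\<Union>a\<in>A. {..fst (Rep_long_ray a)}) \<noteq> UNIV"
    using omega1_uncountable by auto
  then obtain c where "c \<notin> (\<Union>a\<in>A. {..fst (Rep_long_ray a)})" by blast
  then show ?thesis
    by (intro exI[of _ "Abs_long_ray (c, 0)"]) (auto simp: less_long_ray_iff not_le)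
qed

lemma bdd_above_countable_long_ray: "countable A \<Longrightarrow> bdd_above (A :: long_ray set)"
  using long_ray_gt_countable[of A] by (auto simp: bdd_above_def intro: less_imp_le)

lemma long_ray_gt_ex: "\<exists>y. (x :: long_ray) < y"
  using long_ray_gt_countable[of "{x}"] by simp

text \<open>A block has no last element, so the point can be found in the block of \<open>x\<close>
  even if \<open>y\<close> lies in a later one.\<close>

lemma long_ray_rational_between:
  assumes "x < y"
  shows "\<exists>r. r \<in> \<rat> \<and> 0 \<le> r \<and> r < 1 \<and> x < Abs_long_ray (fst (Rep_long_ray x), r) \<and>
    Abs_long_ray (fst (Rep_long_ray x), r) < y"
proof -
  let ?u = "if fst (Rep_long_ray x) = fst (Rep_long_ray y) then snd (Rep_long_ray y) else 1"
  have "snd (Rep_long_ray x) < ?u"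
    using assms snd_Rep_long_ray[of x] by (auto simp: less_long_ray_iff)
  then obtain r where r: "r \<in> \<rat>" "snd (Rep_long_ray x) < r" "r < ?u"
    using Rats_dense_in_real by blast
  then have "0 \<le> r" "r < 1"
    using snd_Rep_long_ray[of x] snd_Rep_long_ray[of y] by (auto split: if_splits)
  then show ?thesis
    using r assms by (intro exI[of _ r]) (auto simp: less_long_ray_iff split: if_splits)
qed

instance long_ray :: linear_continuum_topology
proof
  show "\<exists>z. x < z \<and> z < y" if "x < y" for x y :: long_ray
    using long_ray_rational_between[OF that] by blast
  show "\<exists>a b :: long_ray. a \<noteq> b"
    using long_ray_gt_ex[of 0] by (metis less_irrefl)
qed

lemma long_ray_separable_atMost:
  obtains D :: "long_ray set" where "countable D" "D \<subseteq> {..c}" "{..c} \<subseteq> closure D"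
proof -
  define D0 where "D0 = Abs_long_ray ` ({..fst (Rep_long_ray c)} \<times> \<rat>)"
  \<comment> \<open>\<open>0\<close> is added by hand: every other point is approximated from its
    left, where \<open>0\<close> has nothing.\<close>
  define D where "D = insert 0 (D0 \<inter> {..c})"
  have "countable D0"
    unfolding D0_def using omega1_countable_lessThan countable_rat
    by (intro countable_image countable_SIGMA) (auto simp: ivl_disj_un_singleton(2)[symmetric])
  then have "countable D" by (simp add: D_def)
  moreover have "D \<subseteq> {..c}" by (auto simp: D_def long_ray_zero_le)
  moreover have "x \<in> closure D" if x: "x \<le> c" for x
  proof (cases "x = 0")
    case True
    then show ?thesis using closure_subset[of D] by (auto simp: D_def)
  next
    case False
    then have "0 < x" using long_ray_zero_le by (simp add: order.not_eq_order_implies_strict)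
    show ?thesis unfolding closure_iff_nhds_not_empty
    proof (intro allI impI)
      fix A V assume V: "V \<subseteq> A" "open V" "x \<in> V"
      obtain b where b: "b < x" "{b<..x} \<subseteq> V"
        using open_left[OF V(2,3) \<open>0 < x\<close>] by blast
      obtain r where r: "r \<in> \<rat>" "0 \<le> r" "r < 1" "b < Abs_long_ray (fst (Rep_long_ray b), r)"
         "Abs_long_ray (fst (Rep_long_ray b), r) < x"
        using long_ray_rational_between[OF b(1)] by blast
      have "fst (Rep_long_ray b) \<le> fst (Rep_long_ray c)"
        using b(1) x by (auto simp: less_long_ray_iff less_eq_long_ray_def)
      then have "Abs_long_ray (fst (Rep_long_ray b), r) \<in> D"
        using r x by (auto simp: D_def D0_def)
      moreover have "Abs_long_ray (fst (Rep_long_ray b), r) \<in> V" using b r by auto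
      ultimately show "D \<inter> A \<noteq> {}" using V(1) by blast
    qed
  qed
  ultimately show ?thesis using that[of D] by auto
qed

text \<open>The embedding is a weighted sum of the projections of the ray to the intervals between successive
  ordinals up to \<open>e\<close>.\<close>

lemma long_ray_real_embedding:
  "\<exists>\<psi> :: long_ray \<Rightarrow> real. continuous_on UNIV \<psi> \<and> strict_mono_on {..e} \<psi>"
proof -
  define p :: "omega1 \<Rightarrow> long_ray \<Rightarrow> real" where "p b x =
    (if fst (Rep_long_ray x) < b then 0 else if fst (Rep_long_ray x) = b then snd (Rep_long_ray x) else 1)" for b x
  have p_range: "0 \<le> p b x" "p b x \<le> 1" for b x
    using snd_Rep_long_ray[of x] by (auto simp: p_def)
  have p_mono: "p b x \<le> p b y" if "x \<le> y" for b x y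
    using that snd_Rep_long_ray[of x] snd_Rep_long_ray[of y] by (auto simp: p_def less_eq_long_ray_def)
  have p_cont: "continuous_on UNIV (p b)" for b
  proof -
    have lt: "open (p b -` {..<c})" for c
    proof (cases "c \<le> 0 \<or> 1 < c")
      case True
      then have "p b -` {..<c} = {} \<or> p b -` {..<c} = UNIV"
        using p_range[of b] by (auto simp: not_less) (meson le_less_trans not_le order_trans)+
      then show ?thesis by auto
    next
      case False
      \<comment> \<open>A union replaces the single initial segment below \<open>(b, c)\<close>: for
        \<open>c = 1\<close> this point is missing, as blocks are half-open.\<close>
      have "x \<in> p b -` {..<c} \<longleftrightarrow> (\<exists>r\<in>{r. 0 < r \<and> r < 1 \<and> r \<le> c}. x < Abs_long_ray (b, r))" for x
      proof
        assume "x \<in> p b -` {..<c}"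
        then have "max 0 (p b x) < min 1 c" using False p_range[of b x] by auto
        then obtain r where "max 0 (p b x) < r" "r < min 1 c" using dense by blast
        then show "\<exists>r\<in>{r. 0 < r \<and> r < 1 \<and> r \<le> c}. x < Abs_long_ray (b, r)"
          by (intro bexI[of _ r]) (auto simp: less_long_ray_iff p_def split: if_splits)
      next
        assume "\<exists>r\<in>{r. 0 < r \<and> r < 1 \<and> r \<le> c}. x < Abs_long_ray (b, r)"
        then show "x \<in> p b -` {..<c}"
          using False by (auto simp: less_long_ray_iff p_def)
      qed
      then have "p b -` {..<c} = (\<Union>r\<in>{r. 0 < r \<and> r < 1 \<and> r \<le> c}. {..<Abs_long_ray (b, r)})"
        by blast
      then show ?thesis by (auto intro!: open_UN)
    qed
    have gt: "open (p b -` {c<..})" for c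
    proof (cases "c < 0 \<or> 1 \<le> c")
      case True
      then have "p b -` {c<..} = {} \<or> p b -` {c<..} = UNIV"
        using p_range[of b] by (auto simp: not_less) (meson less_le_trans not_le order_trans)+
      then show ?thesis by auto
    next
      case False
      then have "p b -` {c<..} = {Abs_long_ray (b, c)<..}"
        by (auto simp: less_long_ray_iff p_def snd_Rep_long_ray split: if_splits)
      then show ?thesis by simp
    qed
    show ?thesis
      by (rule continuous_on_generate_topology[OF open_generated_order]) (use lt gt in auto)
  qed
  define A where "A = {..fst (Rep_long_ray e)}"
  have A: "countable A" "A \<noteq> {}"
    using omega1_countable_lessThan by (auto simp: A_def ivl_disj_un_singleton(2)[symmetric])
  define \<psi> where "\<psi> x = (\<Sum>n. (1/2) ^ n * p (from_nat_into A n) x)" for x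
  have bound: "norm ((1/2) ^ n * p b x) \<le> (1/2) ^ n" for n b x
    using p_range[of b x] by (simp add: mult_left_le)
  have summ: "summable (\<lambda>n. (1/2) ^ n * p (from_nat_into A n) x)" for x
    by (rule summable_comparison_test'[where N = 0, OF _ bound]) (simp add: summable_geometric)
  have "uniform_limit UNIV (\<lambda>n x. \<Sum>i<n. (1/2) ^ i * p (from_nat_into A i) x) \<psi> sequentially"
    unfolding \<psi>_def by (rule Weierstrass_m_test[OF bound]) (simp add: summable_geometric)
  then have "continuous_on UNIV \<psi>"
    by (rule uniform_limit_theorem[rotated])
      (auto intro!: always_eventually continuous_intros p_cont)
  moreover have "\<psi> x < \<psi> y" if "x < y" "y \<le> e" for x y
  proof -
    \<comment> \<open>The term for the ordinal of \<open>x\<close> increases strictly: it is below 1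
      at \<open>x\<close>, and \<open>y\<close> is either further in the same block or past it. All
      other terms are monotone.\<close>
    let ?b = "fst (Rep_long_ray x)"
    have "?b \<in> A" using that by (auto simp: A_def less_long_ray_iff less_eq_long_ray_def)
    then obtain m where m: "from_nat_into A m = ?b"
      using from_nat_into_surj[OF A(1)] by blast
    have "p ?b x < p ?b y"
      using that(1) snd_Rep_long_ray[of x] by (auto simp: p_def less_long_ray_iff)
    then have "0 < (\<Sum>n. (1/2) ^ n * p (from_nat_into A n) y - (1/2) ^ n * p (from_nat_into A n) x)"
      using p_mono that(1) m
      by (intro suminf_pos2[of _ m] summable_diff summ)
        (auto simp: mult_le_cancel_left intro!: p_mono)
    then show ?thesis
      by (simp add: \<psi>_def flip: suminf_diff[OF summ summ])
  qed
  ultimately show ?thesis by (auto simp: strict_mono_on_def)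
qed

subsection \<open>Unbounded maps\<close>

text \<open>The sequence \<open>u\<close> leaps at step \<open>m\<close> over a point of the set
  with index \<open>fst (prod_decode m)\<close>, so it serves every index infinitely often. Both
  coordinates of the points visited lie between consecutive terms, hence they converge to the same
  supremum \<open>a\<close>.\<close>

lemma interleaving:
  fixes Z :: "nat \<Rightarrow> (long_ray \<times> long_ray) set"
  assumes Z: "\<And>n c. \<exists>x y. (x, y) \<in> Z n \<and> c \<le> x \<and> c \<le> y"
  shows "\<exists>a>b. \<forall>n. (a, a) \<in> closure (Z n)"
proof -
  obtain X Y where XY: "\<And>n c. (X n c, Y n c) \<in> Z n \<and> c \<le> X n c \<and> c \<le> Y n c"
    using Z by metis
  obtain N :: "long_ray \<Rightarrow> long_ray" where N: "\<And>x. x < N x"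
    using long_ray_gt_ex by metis
  define u where "u = rec_nat (N b) (\<lambda>m c. N (max (X (fst (prod_decode m)) c) (Y (fst (prod_decode m)) c)))"
  have u0: "u 0 = N b"
    and uS: "\<And>m. u (Suc m) = N (max (X (fst (prod_decode m)) (u m)) (Y (fst (prod_decode m)) (u m)))"
    by (simp_all add: u_def)
  have step: "X (fst (prod_decode m)) (u m) < u (Suc m)" "Y (fst (prod_decode m)) (u m) < u (Suc m)" for m
    unfolding uS using N[of "max (X (fst (prod_decode m)) (u m)) (Y (fst (prod_decode m)) (u m))"] by simp_all
  have "strict_mono u"
    unfolding strict_mono_Suc_iff using step(1) XY le_less_trans by blast
  define a where "a = Sup (range u)"
  have bdd: "bdd_above (range u)" by (intro bdd_above_countable_long_ray) simp
  have ua: "u m < a" for m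
    using cSup_upper[OF _ bdd, of "u (Suc m)"] \<open>strict_mono u\<close>
    unfolding a_def by (meson lessI less_le_trans rangeI strict_monoD)
  have "b < a" using N[of b] ua[of 0] u0 by simp
  moreover have "(a, a) \<in> closure (Z n)" for n
    unfolding closure_iff_nhds_not_empty
  proof (intro allI impI)
    fix A V assume V: "V \<subseteq> A" "open V" "(a, a) \<in> V"
    obtain P Q where PQ: "open P" "open Q" "a \<in> P" "a \<in> Q" "P \<times> Q \<subseteq> V"
      using open_prod_elim[OF V(2,3)] by (metis mem_Sigma_iff)
    obtain c where c: "c < a" "{c<..a} \<subseteq> P \<inter> Q"
      using open_left[of "P \<inter> Q" a b] PQ \<open>b < a\<close> by (auto intro: open_Int)
    obtain m0 where m0: "c < u m0"
      using less_cSup_iff[OF _ bdd, of c] c(1) by (auto simp: a_def)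
    \<comment> \<open>A step that serves \<open>n\<close> and comes no earlier than
      \<open>m0\<close>.\<close>
    define m where "m = prod_encode (n, m0)"
    have "u m0 \<le> u m"
      using \<open>strict_mono u\<close> le_prod_encode_2[of m0 n] by (simp add: m_def strict_mono_less_eq)
    then have "X n (u m) \<in> {c<..a}" "Y n (u m) \<in> {c<..a}"
      using step[of m] ua[of "Suc m"] XY[of n "u m"] m0 by (auto simp: m_def)
    then have "(X n (u m), Y n (u m)) \<in> A" using c(2) PQ(5) V(1) by blast
    then show "Z n \<inter> A \<noteq> {}" using XY by blast
  qed
  ultimately show ?thesis by blast
qed

text \<open>The values on \<open>D\<close> are countably many and so have a common bound, which
  passes to the closure by continuity.\<close>

lemma bdd_above_image_separable:
  fixes f :: "'a::topological_space \<Rightarrow> long_ray"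
  assumes "continuous_on UNIV f" "countable D" "A \<subseteq> closure D"
  shows "bdd_above (f ` A)"
proof -
  obtain b where "\<forall>x\<in>D. f x \<le> b"
    using bdd_above_countable_long_ray[of "f ` D"] assms(2) by (auto simp: bdd_above_def)
  moreover have "closed {x. f x \<le> b}"
    using assms(1) by (intro closed_Collect_le continuous_on_const)
  ultimately have "closure D \<subseteq> {x. f x \<le> b}" by (intro closure_minimal) auto
  then show ?thesis using assms(3) by (auto simp: bdd_above_def)
qed

lemma bdd_above_image_atMost:
  assumes "continuous_on UNIV (f :: long_ray \<Rightarrow> long_ray)"
  shows "bdd_above (f ` {..c})"
  by (rule long_ray_separable_atMost[of c]) (use bdd_above_image_separable[OF assms] in auto)

lemma closed_graph_long_ray:
  assumes "continuous_on UNIV (g :: long_ray \<Rightarrow> long_ray)"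
  shows "closed {(x, y). y = g x}"
proof -
  have "closed {p. snd p = g (fst p)}"
    by (intro closed_Collect_eq continuous_intros continuous_on_compose2[OF assms]) auto
  then show ?thesis by (simp add: case_prod_unfold)
qed

text \<open>Since \<open>g\<close> is bounded on \<open>{..c}\<close>, larger values occur only past
  \<open>c\<close>. This is the form in which \<open>interleaving\<close> is applied to an unbounded
  map.\<close>

lemma unbounded_graph:
  assumes "continuous_on UNIV (g :: long_ray \<Rightarrow> long_ray)" "\<not> bdd_above (range g)"
  shows "\<exists>x y. (x, y) \<in> {(x, y). y = g x} \<and> c \<le> x \<and> c \<le> y"
proof -
  obtain b where b: "\<And>x. x \<le> c \<Longrightarrow> g x \<le> b"
    using bdd_above_image_atMost[OF assms(1), of c] by (auto simp: bdd_above_def)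
  have "\<forall>M. \<exists>x. M < g x"
    using assms(2) by (auto simp: bdd_above_def not_le)
  then obtain x where "max b c < g x" by blast
  moreover from this have "c < x" using b[of x] by (force simp: not_le)
  ultimately show ?thesis by (auto intro!: exI[of _ x] intro: less_imp_le)
qed

text \<open>If \<open>g\<close> returned to values up to \<open>b\<close> cofinally,
  \<open>interleaving\<close> would give some \<open>a > b\<close> with both \<open>g a = a\<close>
  and \<open>g a \<le> b\<close>.\<close>

lemma unbounded_tends:
  assumes g: "continuous_on UNIV (g :: long_ray \<Rightarrow> long_ray)" "\<not> bdd_above (range g)"
  shows "\<exists>c. \<forall>x\<ge>c. b \<le> g x"
proof (rule ccontr)
  assume "\<not> ?thesis"
  then have *: "\<exists>x\<ge>c. g x \<le> b" for c by (meson linear)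
  define Z where "Z n = (if n = 0 then {(x, y). y = g x} else {(x, y). x = y \<and> g x \<le> b})" for n :: nat
  have cl: "closed (Z n)" for n
  proof -
    have "closed ({p. fst p = snd p} \<inter> {p. g (fst p) \<le> b})"
      by (intro closed_Int closed_Collect_eq closed_Collect_le continuous_intros
          continuous_on_compose2[OF g(1)]) auto
    then show ?thesis using closed_graph_long_ray[OF g(1)]
      by (simp add: Z_def case_prod_unfold Collect_conj_eq)
  qed
  have "\<exists>x y. (x, y) \<in> Z n \<and> c \<le> x \<and> c \<le> y" for n c
    using unbounded_graph[OF g, of c] *[of c] by (auto simp: Z_def)
  then obtain a where a: "a > b" "\<And>n. (a, a) \<in> closure (Z n)"
    using interleaving[of Z] by blast
  then have "(a, a) \<in> Z 0" "(a, a) \<in> Z 1" using cl by auto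
  then show False using a(1) by (simp add: Z_def)
qed

text \<open>Take a common fixed point \<open>a\<close> of the unbounded maps \<open>h (\<cdot>, y)\<close> with \<open>y \<in> D\<close>, above a bound \<open>b\<close> of
  the bounded ones. By density \<open>h (a, \<cdot>)\<close> has no values between \<open>b\<close> and \<open>a\<close> on \<open>Y\<close>, so only one kind occurs.\<close>

lemma unbounded_fibres_connected:
  fixes h :: "long_ray \<times> 'b::topological_space \<Rightarrow> long_ray"
  assumes cont: "continuous_on (UNIV \<times> Y) h" and Y: "connected Y"
    and D: "countable D" "D \<subseteq> Y" "Y \<subseteq> closure D"
    and y: "y0 \<in> Y" "y1 \<in> Y" and unb: "\<not> bdd_above (range (\<lambda>x. h (x, y0)))"
  shows "\<not> bdd_above (range (\<lambda>x. h (x, y1)))"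
proof
  assume bdd1: "bdd_above (range (\<lambda>x. h (x, y1)))"
  define E where "E = insert y0 (insert y1 D)"
  have E: "countable E" "E \<noteq> {}" "E \<subseteq> Y" "Y \<subseteq> closure E"
    using D y closure_mono[of D E] by (auto simp: E_def)
  define B where "B = {y \<in> E. bdd_above (range (\<lambda>x. h (x, y)))}"
  have "\<forall>y\<in>B. \<exists>b. \<forall>x. h (x, y) \<le> b" by (auto simp: B_def bdd_above_def)
  then obtain \<beta> where \<beta>: "\<And>y x. y \<in> B \<Longrightarrow> h (x, y) \<le> \<beta> y" by metis
  have "countable (\<beta> ` B)" using E(1) by (intro countable_image) (auto simp: B_def)
  then obtain b where b: "\<And>y. y \<in> B \<Longrightarrow> \<beta> y < b"
    using long_ray_gt_countable[of "\<beta> ` B"] by auto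
  define d where "d = from_nat_into E"
  have d: "range d = E" unfolding d_def using range_from_nat_into[OF E(2,1)] .
  have fibre: "continuous_on UNIV (\<lambda>x. h (x, y))" if "y \<in> Y" for y
    by (rule continuous_on_compose2[OF cont]) (use that in \<open>auto intro!: continuous_intros\<close>)
  \<comment> \<open>A bounded fibre is to impose no condition, so the diagonal stands in for its
    graph.\<close>
  define Z where "Z n = (if d n \<in> B then {(x, y). y = x} else {(x, y). y = h (x, d n)})" for n
  have dY: "d n \<in> Y" for n using d E by auto
  have cl: "closed (Z n)" for n
    using closed_graph_long_ray[OF fibre[OF dY]] closed_graph_long_ray[of "\<lambda>x. x"]
    by (auto simp: Z_def)
  have "\<exists>x y. (x, y) \<in> Z n \<and> c \<le> x \<and> c \<le> y" for n c
    using unbounded_graph[OF fibre[OF dY], of n c] d by (auto simp: Z_def B_def)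
  then obtain a where a: "a > b" "\<And>n. (a, a) \<in> closure (Z n)"
    using interleaving[of Z] by blast
  have fix_or: "h (a, y) = a \<and> y \<notin> B \<or> h (a, y) < b \<and> y \<in> B" if y: "y \<in> E" for y
  proof (cases "y \<in> B")
    case True
    then show ?thesis using \<beta>[of y a] b[of y] by simp
  next
    case False
    obtain n where "y = d n" using d y by blast
    then have "(a, a) \<in> Z n" using a cl by simp
    then show ?thesis using False \<open>y = d n\<close> by (simp add: Z_def)
  qed
  have cont_a: "continuous_on Y (\<lambda>y. h (a, y))"
    by (rule continuous_on_compose2[OF cont]) (auto intro!: continuous_intros)
  have "closedin (top_of_set Y) (Y \<inter> (\<lambda>y. h (a, y)) -` ({..b} \<union> {a}))"
    by (intro continuous_closedin_preimage[OF cont_a] closed_Un) auto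
  then obtain T where T: "closed T" "Y \<inter> (\<lambda>y. h (a, y)) -` ({..b} \<union> {a}) = Y \<inter> T"
    by (auto simp: closedin_closed)
  have "E \<subseteq> T" using T(2) fix_or E(3) by (fastforce intro: less_imp_le)
  then have "Y \<subseteq> T" using E(4) T(1) closure_minimal by blast
  then have two: "h (a, y) \<le> b \<or> h (a, y) = a" if "y \<in> Y" for y using T(2) that by blast
  obtain c where c: "b < c" "c < a" using a(1) dense by blast
  have "h (a, y0) = a" "h (a, y1) < b"
    using fix_or[of y0] fix_or[of y1] unb bdd1 by (auto simp: E_def B_def)
  then have le: "h (a, y1) \<le> c" "c \<le> h (a, y0)" using c by simp_all
  have "c \<in> (\<lambda>y. h (a, y)) ` Y"
    using connectedD_interval[OF connected_continuous_image[OF cont_a Y] imageI[OF y(2)] imageI[OF y(1)] le] .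
  then obtain y where "y \<in> Y" "h (a, y) = c" by blast
  then show False using two[of y] c by (metis leD less_irrefl)
qed

section \<open>Growth on one octant, read off from its two sides\<close>

text \<open>As in \<open>unbounded_tends\<close>: the diagonal provides a fixed point
  \<open>h (a, a) = a > b\<close>, which contradicts small values at pairs of large points.\<close>

lemma diagonal_tends:
  assumes h: "continuous_on UNIV (h :: long_ray \<times> long_ray \<Rightarrow> long_ray)"
    and unb: "\<not> bdd_above (range (\<lambda>x. h (x, x)))"
  shows "\<exists>c. \<forall>x\<ge>c. \<forall>y\<ge>c. b \<le> h (x, y)"
proof (rule ccontr)
  assume "\<not> ?thesis"
  then have *: "\<exists>x y. c \<le> x \<and> c \<le> y \<and> h (x, y) \<le> b" for c by (meson linear)
  have diag: "continuous_on UNIV (\<lambda>x. h (x, x))"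
    by (rule continuous_on_compose2[OF h]) (auto intro!: continuous_intros)
  define Z where "Z n = (if n = 0 then {(x, y). y = h (x, x)} else {p. h p \<le> b})" for n :: nat
  have cl: "closed (Z n)" for n
    using closed_graph_long_ray[OF diag] h
    by (auto simp: Z_def intro!: closed_Collect_le)
  have "\<exists>x y. (x, y) \<in> Z n \<and> c \<le> x \<and> c \<le> y" for n c
    using unbounded_graph[OF diag unb, of c] *[of c] by (auto simp: Z_def)
  then obtain a where a: "a > b" "\<And>n. (a, a) \<in> closure (Z n)"
    using interleaving[of Z] by blast
  then have "(a, a) \<in> Z 0" "(a, a) \<in> Z 1" using cl by auto
  then show False using a(1) by (simp add: Z_def)
qed

lemma diagonal_bounded:
  assumes h: "continuous_on UNIV (h :: long_ray \<times> long_ray \<Rightarrow> long_ray)"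
    and bdd: "bdd_above (range (\<lambda>x. h (x, x)))"
  shows "\<exists>b c. \<forall>x\<ge>c. \<forall>y\<ge>c. h (x, y) \<le> b"
proof (rule ccontr)
  assume "\<not> ?thesis"
  then have *: "\<exists>x y. c \<le> x \<and> c \<le> y \<and> b \<le> h (x, y)" for b c by (meson linear)
  obtain b where "\<forall>x. h (x, x) \<le> b" using bdd by (auto simp: bdd_above_def)
  \<comment> \<open>The bound is made strict because the limit point only satisfies
    \<open>b \<le> h (a, a)\<close>.\<close>
  then obtain b where b: "\<And>x. h (x, x) < b" using long_ray_gt_ex le_less_trans by metis
  obtain a where "(a, a) \<in> closure {p. b \<le> h p}"
    using interleaving[of "\<lambda>_. {p. b \<le> h p}"] *[of _ b] by blast
  moreover have "closed {p. b \<le> h p}" using h by (intro closed_Collect_le) auto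
  ultimately show False using b[of a] by simp
qed

text \<open>Both heights lie in one initial segment, which is connected and separable. Exchanging
  \<open>y\<close> and \<open>z\<close> gives the equivalence.\<close>

lemma fibres_unbounded_iff:
  assumes h: "continuous_on UNIV (h :: long_ray \<times> long_ray \<Rightarrow> long_ray)"
    and "\<not> bdd_above (range (\<lambda>x. h (x, y)))"
  shows "\<not> bdd_above (range (\<lambda>x. h (x, z)))"
proof -
  obtain D :: "long_ray set" where D: "countable D" "D \<subseteq> {..max y z}" "{..max y z} \<subseteq> closure D"
    by (rule long_ray_separable_atMost)
  show ?thesis
    by (rule unbounded_fibres_connected[OF continuous_on_subset[OF h] _ D _ _ assms(2)])
      (auto intro: connected_Iic)
qed

text \<open>The line at height \<open>c\<close> is unbounded with the base, yet it runs into the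
  region where a bounded diagonal would bound \<open>h\<close>. This is the constraint that an arrow
  expresses.\<close>

lemma diagonal_unbounded:
  assumes h: "continuous_on UNIV (h :: long_ray \<times> long_ray \<Rightarrow> long_ray)"
    and unb: "\<not> bdd_above (range (\<lambda>x. h (x, 0)))"
  shows "\<not> bdd_above (range (\<lambda>x. h (x, x)))"
proof
  assume "bdd_above (range (\<lambda>x. h (x, x)))"
  then obtain b c where bc: "\<And>x y. c \<le> x \<Longrightarrow> c \<le> y \<Longrightarrow> h (x, y) \<le> b"
    using diagonal_bounded[OF h] by blast
  have cont: "continuous_on UNIV (\<lambda>x. h (x, c))"
    by (rule continuous_on_compose2[OF h]) (auto intro!: continuous_intros)
  obtain b' where b': "b < b'" using long_ray_gt_ex by blast
  obtain d where "\<And>x. d \<le> x \<Longrightarrow> b' \<le> h (x, c)"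
    using unbounded_tends[OF cont fibres_unbounded_iff[OF h unb]] by blast
  from this[of "max c d"] bc[of "max c d" c] b' show False by (simp add: not_le[symmetric])
qed

text \<open>One bound serves the whole strip: bounds for a countable dense set of heights have a
  common bound, and the inequality is closed in \<open>y\<close>.\<close>

lemma fibres_bounded:
  assumes h: "continuous_on UNIV (h :: long_ray \<times> long_ray \<Rightarrow> long_ray)"
    and bdd: "bdd_above (range (\<lambda>x. h (x, 0)))"
  shows "\<exists>b. \<forall>x. \<forall>y\<le>c. h (x, y) \<le> b"
proof -
  obtain D :: "long_ray set" where D: "countable D" "{..c} \<subseteq> closure D"
    by (rule long_ray_separable_atMost)
  have "\<exists>b. \<forall>x. h (x, y) \<le> b" for y
    using fibres_unbounded_iff[OF h, of y 0] bdd by (auto simp: bdd_above_def)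
  then obtain \<beta> where \<beta>: "\<And>x y. h (x, y) \<le> \<beta> y" by metis
  obtain b where b: "\<And>y. y \<in> D \<Longrightarrow> \<beta> y < b"
    using long_ray_gt_countable[of "\<beta> ` D"] D(1) by auto
  have "h (x, y) \<le> b" if "y \<le> c" for x y
  proof -
    have "closed {y. h (x, y) \<le> b}"
      by (intro closed_Collect_le continuous_on_compose2[OF h] continuous_intros) auto
    then have "closure D \<subseteq> {y. h (x, y) \<le> b}"
      using order_trans[OF \<beta> less_imp_le[OF b]] by (intro closure_minimal) auto
    then show ?thesis using D(2) that by auto
  qed
  then show ?thesis by blast
qed

text \<open>The octant consists of a strip \<open>y \<le> c\<close>, controlled by the horizontal
  side, and a part with both coordinates above \<open>c\<close>, controlled by the diagonal.\<close>

lemma octant_bounded: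
  assumes h: "continuous_on UNIV (h :: long_ray \<times> long_ray \<Rightarrow> long_ray)"
    and "bdd_above (range (\<lambda>x. h (x, 0)))" "bdd_above (range (\<lambda>x. h (x, x)))"
  shows "\<exists>b. \<forall>x. \<forall>y\<le>x. h (x, y) \<le> b"
proof -
  obtain b c where bc: "\<And>x y. c \<le> x \<Longrightarrow> c \<le> y \<Longrightarrow> h (x, y) \<le> b"
    using diagonal_bounded[OF h assms(3)] by blast
  obtain b' where b': "\<And>x y. y \<le> c \<Longrightarrow> h (x, y) \<le> b'"
    using fibres_bounded[OF h assms(2)] by blast
  have "h (x, y) \<le> max b b'" if "y \<le> x" for x y
    using bc[of x y] b'[of y x] that by (cases "y \<le> c") (auto simp: le_max_iff_disj)
  then show ?thesis by blast
qed

text \<open>Same splitting as in \<open>octant_bounded\<close>; on the strip, the thresholds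
  \<open>\<xi> y\<close> of countably many dense heights have a common bound
  \<open>d\<close>.\<close>

lemma octant_tends:
  assumes h: "continuous_on UNIV (h :: long_ray \<times> long_ray \<Rightarrow> long_ray)"
    and unb: "\<not> bdd_above (range (\<lambda>x. h (x, 0)))"
  shows "\<exists>c. \<forall>x\<ge>c. \<forall>y. b \<le> h (x, y)"
proof -
  obtain c where c: "\<And>x y. c \<le> x \<Longrightarrow> c \<le> y \<Longrightarrow> b \<le> h (x, y)"
    using diagonal_tends[OF h diagonal_unbounded[OF h unb]] by blast
  obtain D :: "long_ray set" where D: "countable D" "{..c} \<subseteq> closure D"
    by (rule long_ray_separable_atMost)
  have "continuous_on UNIV (\<lambda>x. h (x, y))" for y
    by (rule continuous_on_compose2[OF h]) (auto intro!: continuous_intros)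
  then have "\<exists>\<xi>. \<forall>x\<ge>\<xi>. b \<le> h (x, y)" for y
    using unbounded_tends fibres_unbounded_iff[OF h unb] by blast
  then obtain \<xi> where \<xi>: "\<And>x y. \<xi> y \<le> x \<Longrightarrow> b \<le> h (x, y)" by metis
  obtain d where d: "\<And>y. y \<in> D \<Longrightarrow> \<xi> y < d"
    using long_ray_gt_countable[of "\<xi> ` D"] D(1) by auto
  have "b \<le> h (x, y)" if x: "max c d \<le> x" for x y
  proof (cases "y \<le> c")
    case True
    have "closed {y. b \<le> h (x, y)}"
      by (intro closed_Collect_le continuous_on_compose2[OF h] continuous_intros) auto
    then have "closure D \<subseteq> {y. b \<le> h (x, y)}"
      using \<xi> order_trans[OF less_imp_le[OF d]] x by (intro closure_minimal) auto
    then show ?thesis using D(2) True by auto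
  qed (use c x in auto)
  then show ?thesis by blast
qed

lemma square_bounded:
  assumes h: "continuous_on UNIV (h :: long_ray \<times> long_ray \<Rightarrow> long_ray)"
  shows "\<exists>b. \<forall>x\<le>c. \<forall>y\<le>c. h (x, y) \<le> b"
proof -
  obtain D :: "long_ray set" where D: "countable D" "{..c} \<subseteq> closure D"
    by (rule long_ray_separable_atMost)
  have "bdd_above (h ` ({..c} \<times> {..c}))"
    by (rule bdd_above_image_separable[OF h, of "D \<times> D"]) (use D in \<open>auto simp: closure_Times\<close>)
  then show ?thesis by (auto simp: bdd_above_def)
qed

subsection \<open>Homotopies between maps that are close\<close>

text \<open>Points that are not separated by \<open>E\<close> can be joined continuously: at each pair of distinct points the
  set of elements of \<open>E\<close> above both is locally constant, hence so is the chosen element \<open>e\<close>, and the segment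
  between the images of the points under an embedding of \<open>{..e}\<close> into the real line can be pulled back.\<close>

lemma interpolation:
  fixes E :: "long_ray set"
  assumes E: "\<And>c. \<exists>e\<in>E. c \<le> e"
  defines "M \<equiv> {(a, b). \<forall>e\<in>E. \<not> (min a b < e \<and> e < max a b)}"
  shows "\<exists>m. continuous_on (M \<times> {0..1::real}) m \<and> (\<forall>p\<in>M. m (p, 0) = fst p \<and> m (p, 1) = snd p)"
proof -
  obtain \<psi> :: "long_ray \<Rightarrow> long_ray \<Rightarrow> real" where
    \<psi>_cont: "\<And>e. continuous_on UNIV (\<psi> e)" and "\<And>e. strict_mono_on {..e} (\<psi> e)"
    using long_ray_real_embedding by metis
  then have \<psi>_mono: "x < y \<Longrightarrow> y \<le> e \<Longrightarrow> \<psi> e x < \<psi> e y" for e x y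
    by (simp add: strict_mono_on_def)
  then have \<psi>_less: "x \<le> e \<Longrightarrow> y \<le> e \<Longrightarrow> \<psi> e x < \<psi> e y \<longleftrightarrow> x < y" for e x y
    by (metis less_asym neqE)
  define top where "top p = (SOME e. e \<in> {e\<in>E. max (fst p) (snd p) \<le> e})" for p
  have top: "max (fst p) (snd p) \<le> top p" for p
    using someI_ex[of "\<lambda>e. e \<in> {e\<in>E. max (fst p) (snd p) \<le> e}"] E[of "max (fst p) (snd p)"]
    unfolding top_def by blast
  define v where "v e q = (1 - snd q) * \<psi> e (fst (fst q)) + snd q * \<psi> e (snd (fst q))"
    for e and q :: "(long_ray \<times> long_ray) \<times> real"
  \<comment> \<open>A preimage of the point \<open>v\<close> of the segment exists by the
    intermediate value theorem and is unique below \<open>top\<close>, where \<open>\<psi>\<close>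
    is strictly monotone.\<close>
  define m where "m q = (SOME z. min (fst (fst q)) (snd (fst q)) \<le> z \<and> z \<le> max (fst (fst q)) (snd (fst q)) \<and>
     \<psi> (top (fst q)) z = v (top (fst q)) q)" for q
  have m: "min (fst (fst q)) (snd (fst q)) \<le> m q \<and> m q \<le> max (fst (fst q)) (snd (fst q)) \<and>
     \<psi> (top (fst q)) (m q) = v (top (fst q)) q" if q: "snd q \<in> {0..1}" for q
    unfolding m_def
  proof (rule someI_ex)
    let ?a = "fst (fst q)" and ?b = "snd (fst q)" and ?e = "top (fst q)"
    have "min (\<psi> ?e ?a) (\<psi> ?e ?b) \<le> v ?e q \<and> v ?e q \<le> max (\<psi> ?e ?a) (\<psi> ?e ?b)"
    proof -
      have "v ?e q \<in> closed_segment (\<psi> ?e ?a) (\<psi> ?e ?b)"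
        using q by (auto simp: v_def closed_segment_def)
      then show ?thesis
        by (auto simp: closed_segment_eq_real_ivl split: if_splits)
    qed
    moreover have "min (\<psi> ?e ?a) (\<psi> ?e ?b) = \<psi> ?e (min ?a ?b)" "max (\<psi> ?e ?a) (\<psi> ?e ?b) = \<psi> ?e (max ?a ?b)"
    proof -
      have "?a \<le> ?e" "?b \<le> ?e" using top[of "fst q"] by simp_all
      then have "?a \<le> ?b \<Longrightarrow> \<psi> ?e ?a \<le> \<psi> ?e ?b" "?b \<le> ?a \<Longrightarrow> \<psi> ?e ?b \<le> \<psi> ?e ?a"
        by (metis \<psi>_less not_le)+
      then show "min (\<psi> ?e ?a) (\<psi> ?e ?b) = \<psi> ?e (min ?a ?b)" "max (\<psi> ?e ?a) (\<psi> ?e ?b) = \<psi> ?e (max ?a ?b)"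
        using linear[of ?a ?b] by (metis min_absorb1 min_absorb2 max_absorb1 max_absorb2)+
    qed
    ultimately show "\<exists>z\<ge>min ?a ?b. z \<le> max ?a ?b \<and> \<psi> ?e z = v ?e q"
      by (intro IVT') (auto intro: continuous_on_subset[OF \<psi>_cont] simp: min_le_iff_disj)
  qed
  have m_eqI: "m q = z" if "snd q \<in> {0..1}" "z \<le> max (fst (fst q)) (snd (fst q))" "\<psi> (top (fst q)) z = v (top (fst q)) q" for q z
    using m[OF that(1)] that(2,3) top[of "fst q"] \<psi>_less[of z "top (fst q)" "m q"] \<psi>_less[of "m q" "top (fst q)" z]
    by (metis neqE order.irrefl order.trans)
  have ends: "m (p, 0) = fst p" "m (p, 1) = snd p" for p
    by (rule m_eqI; simp add: v_def)+
  have "continuous_on (M \<times> {0..1}) m"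
    unfolding continuous_on_def
  proof
    fix q0 :: "(long_ray \<times> long_ray) \<times> real"
    assume q0: "q0 \<in> M \<times> {0..1}"
    let ?F = "at q0 within M \<times> {0..1}"
    let ?lo = "\<lambda>q :: (long_ray \<times> long_ray) \<times> real. min (fst (fst q)) (snd (fst q))"
    let ?hi = "\<lambda>q :: (long_ray \<times> long_ray) \<times> real. max (fst (fst q)) (snd (fst q))"
    have in_M: "\<forall>\<^sub>F q in ?F. q \<in> M \<times> {0..1}"
      by (simp add: eventually_at_filter)
    have lim: "((\<lambda>q. fst (fst q)) \<longlongrightarrow> fst (fst q0)) ?F" "((\<lambda>q. snd (fst q)) \<longlongrightarrow> snd (fst q0)) ?F"
      "(snd \<longlongrightarrow> snd q0) ?F"
      by (intro tendsto_intros)+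
    have lim_lo: "(?lo \<longlongrightarrow> ?lo q0) ?F" and lim_hi: "(?hi \<longlongrightarrow> ?hi q0) ?F"
      by (intro tendsto_min tendsto_max lim)+
    have mq0: "?lo q0 \<le> m q0" "m q0 \<le> ?hi q0" "\<psi> (top (fst q0)) (m q0) = v (top (fst q0)) q0"
      using m[of q0] q0 by auto
    show "(m \<longlongrightarrow> m q0) ?F"
    proof (cases "?lo q0 = ?hi q0")
      \<comment> \<open>Where the two points coincide, \<open>top\<close> need not be locally
        constant; there \<open>m\<close> is squeezed between minimum and maximum.\<close>
      case True
      then have eq: "m q0 = ?lo q0" "m q0 = ?hi q0" using mq0(1,2) by (metis order.antisym)+
      show ?thesis
      proof (rule order_tendstoI)
        fix c assume "c < m q0"
        then have "\<forall>\<^sub>F q in ?F. c < ?lo q" using order_tendstoD(1)[OF lim_lo] eq(1) by simp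
        then show "\<forall>\<^sub>F q in ?F. c < m q"
          using in_M
        proof eventually_elim
          case (elim q)
          have "?lo q \<le> m q" using m[of q] elim(2) by (simp add: mem_Times_iff)
          with elim(1) show ?case by (rule less_le_trans)
        qed
      next
        fix c assume "m q0 < c"
        then have "\<forall>\<^sub>F q in ?F. ?hi q < c" using order_tendstoD(2)[OF lim_hi] eq(2) by simp
        then show "\<forall>\<^sub>F q in ?F. m q < c"
          using in_M
        proof eventually_elim
          case (elim q)
          have "m q \<le> ?hi q" using m[of q] elim(2) by (simp add: mem_Times_iff)
          then show ?case using elim(1) by (rule le_less_trans)
        qed
      qed
    next
      case False
      then have "?lo q0 < ?hi q0" by (simp add: min_def max_def split: if_splits)
      then obtain d where d: "?lo q0 < d" "d < ?hi q0" using dense by blast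
      define e where "e = (SOME e. e \<in> {e\<in>E. d \<le> e})"
      \<comment> \<open>No element of \<open>E\<close> separates the two points, so lying above
        their maximum means lying above \<open>d\<close>. The conditions on \<open>d\<close> are
        open and persist near \<open>q0\<close>.\<close>
      have top_eq: "top (fst q) = e" if q: "q \<in> M \<times> {0..1}" "?lo q < d" "d < ?hi q" for q
      proof -
        have "\<not> (?lo q < x \<and> x < ?hi q)" if "x \<in> E" for x
          using that q(1) by (auto simp: M_def)
        then have "{e\<in>E. ?hi q \<le> e} = {e\<in>E. d \<le> e}"
          using q(2,3) by (metis (no_types, lifting) less_imp_le less_le_trans not_le order.trans)
        then show ?thesis by (simp add: top_def e_def)
      qed
      have top0: "top (fst q0) = e" using top_eq q0 d by blast
      have ev_top: "\<forall>\<^sub>F q in ?F. top (fst q) = e \<and> m q \<le> e \<and> \<psi> e (m q) = v e q"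
        using in_M order_tendstoD(2)[OF lim_lo d(1)] order_tendstoD(1)[OF lim_hi d(2)]
      proof eventually_elim
        case (elim q)
        then have "top (fst q) = e" by (rule top_eq)
        moreover from this have "m q \<le> e"
          using m[of q] top[of "fst q"] elim(1) order.trans by (metis SigmaE snd_conv)
        ultimately show ?case using m[of q] elim(1) by (simp add: mem_Times_iff)
      qed
      have \<psi>_lim: "((\<lambda>x. \<psi> e (f x)) \<longlongrightarrow> \<psi> e l) ?F" if "(f \<longlongrightarrow> l) ?F" for f l
        using continuous_on_tendsto_compose[OF \<psi>_cont that] by simp
      have v_lim: "(v e \<longlongrightarrow> v e q0) ?F"
        unfolding v_def by (intro tendsto_intros \<psi>_lim lim)
      have m0: "m q0 \<le> e" "\<psi> e (m q0) = v e q0"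
        using mq0 order.trans[OF mq0(2) top] top0 by simp_all
      show ?thesis
      proof (rule order_tendstoI)
        fix c assume c: "c < m q0"
        then have "\<psi> e c < v e q0" using m0 \<psi>_mono by metis
        from ev_top order_tendstoD(1)[OF v_lim this] show "\<forall>\<^sub>F q in ?F. c < m q"
        proof eventually_elim
          case (elim q)
          then show ?case using \<psi>_less[of c e "m q"] c m0(1) by auto
        qed
      next
        fix c assume c: "m q0 < c"
        show "\<forall>\<^sub>F q in ?F. m q < c"
        \<comment> \<open>\<open>\<psi> e\<close> compares points only up to \<open>e\<close>; for
          larger \<open>c\<close> the bound \<open>m q \<le> e\<close> suffices.\<close>
        proof (cases "c \<le> e")
          case True
          then have "v e q0 < \<psi> e c" using m0 \<psi>_mono c by metis
          from ev_top order_tendstoD(2)[OF v_lim this] show ?thesis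
          proof eventually_elim
            case (elim q)
            then show ?case using \<psi>_less[of "m q" e c] True by auto
          qed
        next
          case False
          from ev_top show ?thesis by eventually_elim (use False in auto)
        qed
      qed
    qed
  qed
  then show ?thesis using ends by blast
qed

lemma homotopic_if_not_separated:
  fixes f g :: "'a \<Rightarrow> long_ray"
  assumes f: "continuous_map X euclidean f" and g: "continuous_map X euclidean g"
    and E: "\<And>c. \<exists>e\<in>E. c \<le> e"
    and sep: "\<And>p e. p \<in> topspace X \<Longrightarrow> e \<in> E \<Longrightarrow> \<not> (min (f p) (g p) < e \<and> e < max (f p) (g p))"
  shows "homotopic_with (\<lambda>_. True) X euclidean f g"
proof -
  define M where "M = {(a, b). \<forall>e\<in>E. \<not> (min a b < e \<and> e < max a b)}"
  obtain m where m: "continuous_on (M \<times> {0..1::real}) m"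
    and ends: "\<And>p. p \<in> M \<Longrightarrow> m (p, 0) = fst p \<and> m (p, 1) = snd p"
    using interpolation[OF E] unfolding M_def by blast
  let ?T = "prod_topology (top_of_set {0..1::real}) X"
  have fg: "(f p, g p) \<in> M" if "p \<in> topspace X" for p
    using sep[OF that] by (auto simp: M_def)
  have "continuous_map ?T (prod_topology (prod_topology euclidean euclidean) euclidean) (\<lambda>q. ((f (snd q), g (snd q)), fst q))"
  proof (intro continuous_map_pairedI)
    show "continuous_map ?T euclidean (\<lambda>q. f (snd q))"
      using continuous_map_compose[OF continuous_map_snd f] by (simp add: o_def)
    show "continuous_map ?T euclidean (\<lambda>q. g (snd q))"
      using continuous_map_compose[OF continuous_map_snd g] by (simp add: o_def)
    show "continuous_map ?T euclidean fst"
      using continuous_map_fst continuous_map_into_fulltopology by blast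
  qed
  then have "continuous_map ?T (top_of_set (M \<times> {0..1})) (\<lambda>q. ((f (snd q), g (snd q)), fst q))"
    using fg by (auto simp: continuous_map_in_subtopology)
  then have "continuous_map ?T euclidean (m \<circ> (\<lambda>q. ((f (snd q), g (snd q)), fst q)))"
    by (rule continuous_map_compose) (use m in simp)
  then show ?thesis
    by (subst homotopic_with) (use ends fg in \<open>auto simp: o_def\<close>)
qed

text \<open>\<open>upper\<close> and \<open>lower\<close> say that two relations between thresholds
  for \<open>g\<close> and for \<open>f\<close> contain arbitrarily large pairs;
  \<open>interleaving\<close> gives cofinally many \<open>a\<close> that serve as both thresholds at
  once.\<close>

theorem homotopic_if_same_growth:
  fixes f g :: "'a \<Rightarrow> long_ray"
  assumes f: "continuous_map X euclidean f" and g: "continuous_map X euclidean g"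
    and upper: "\<And>c. \<exists>b. \<forall>p\<in>topspace X. g p \<le> c \<longrightarrow> f p \<le> b"
    and lower: "\<And>b. \<exists>c. \<forall>p\<in>topspace X. c \<le> g p \<longrightarrow> b \<le> f p"
  shows "homotopic_with (\<lambda>_. True) X euclidean f g"
proof -
  \<comment> \<open>The inequalities on \<open>g\<close> are strict because \<open>(a, a)\<close> is
    only a limit of pairs in the relations \<open>Z n\<close>, which need not be closed.\<close>
  define E where "E = {a. \<forall>p\<in>topspace X. (g p < a \<longrightarrow> f p \<le> a) \<and> (a < g p \<longrightarrow> a \<le> f p)}"
  have "\<exists>e\<in>E. c \<le> e" for c
  proof -
    define Z where "Z n = (if n = 0 then {(x, y). \<forall>p\<in>topspace X. g p \<le> x \<longrightarrow> f p \<le> y}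
      else {(x, y). \<forall>p\<in>topspace X. x \<le> g p \<longrightarrow> y \<le> f p})" for n :: nat
    have "\<exists>x y. (x, y) \<in> Z n \<and> c \<le> x \<and> c \<le> y" for n c
    proof (cases "n = 0")
      case True
      obtain b where "\<forall>p\<in>topspace X. g p \<le> c \<longrightarrow> f p \<le> b" using upper by blast
      then show ?thesis using True
        by (intro exI[of _ c] exI[of _ "max b c"]) (auto simp: Z_def le_max_iff_disj)
    next
      case False
      obtain b where "\<forall>p\<in>topspace X. b \<le> g p \<longrightarrow> c \<le> f p" using lower by blast
      then show ?thesis using False
        by (intro exI[of _ "max b c"] exI[of _ c]) (auto simp: Z_def)
    qed
    then obtain a where a: "c < a" "\<And>n. (a, a) \<in> closure (Z n)"
      using interleaving[of Z] by blast
    have near: "\<exists>x y. (x, y) \<in> Z n \<and> x \<in> U \<and> y \<in> V" if "open U" "open V" "a \<in> U" "a \<in> V" for n U V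
    proof -
      have "U \<times> V \<inter> Z n \<noteq> {}"
        using open_Int_closure_eq_empty[OF open_Times[OF that(1,2)], of "Z n"] a(2) that(3,4) by blast
      then show ?thesis by blast
    qed
    have "a \<in> E" unfolding E_def
    proof safe
      fix p assume p: "p \<in> topspace X" "g p < a"
      show "f p \<le> a"
      proof (rule ccontr)
        assume "\<not> f p \<le> a"
        then show False using near[of "{g p<..}" "{..<f p}" 0] p by (force simp: Z_def)
      qed
    next
      fix p assume p: "p \<in> topspace X" "a < g p"
      show "a \<le> f p"
      proof (rule ccontr)
        assume "\<not> a \<le> f p"
        then show False using near[of "{..<g p}" "{f p<..}" 1] p by (force simp: Z_def)
      qed
    qed
    then show ?thesis using a(1) less_imp_le by blast
  qed
  then show ?thesis
    by (rule homotopic_if_not_separated[OF f g]) (auto simp: E_def min_def max_def split: if_splits)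
qed

subsection \<open>Maps on the pipe\<close>

text \<open>The seam \<open>i\<close> is the side of the octant \<open>i\<close> that is glued to the octant \<open>i - 1\<close>, and
  \<open>far_side S i\<close> is the opposite side, which is glued to the seam \<open>i + 1\<close>.\<close>

definition seam :: "arrow list \<Rightarrow> nat \<Rightarrow> long_ray \<Rightarrow> (long_ray \<times> long_ray) \<times> nat" where
  "seam S i u = ((u, if arr S i = Up then 0 else u), i)"

definition far_side :: "arrow list \<Rightarrow> nat \<Rightarrow> long_ray \<Rightarrow> (long_ray \<times> long_ray) \<times> nat" where
  "far_side S i u = ((u, if arr S i = Up then u else 0), i)"

lemma arr_wrap: "i \<ge> 1 \<Longrightarrow> arr S (wrap (length S) i) = arr S i"
  using arr_wrap_add[of i S 0] by simp

text \<open>In terms of sides, the four gluing rules become a single one.\<close>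

lemma far_side_seam_gluing:
  assumes "i \<in> {1..length S}"
  shows "(far_side S i u, seam S (wrap (length S) (i + 1)) u) \<in> pipe_gluing S"
  using arr_wrap[of "i + 1" S] pipe_gluing.intros[OF assms, of u]
  by (cases "arr S i"; cases "arr S (i + 1)") (simp_all add: seam_def far_side_def)

lemma pipe_gluing_sides:
  assumes "(p, q) \<in> pipe_gluing S"
  shows "\<exists>i\<in>{1..length S}. \<exists>u. p = far_side S i u \<and> q = seam S (wrap (length S) (i + 1)) u"
proof -
  obtain a b i c d j where eq: "p = ((a, b), i)" "q = ((c, d), j)"
    by (metis surj_pair)
  from assms show ?thesis
    unfolding eq
    by (cases rule: pipe_gluing.cases)
      (use arr_wrap[of "i + 1" S] in
        \<open>auto simp: seam_def far_side_def intro!: bexI[of _ i] exI[of _ a]\<close>)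
qed

definition pipe_proj :: "arrow list \<Rightarrow> (long_ray \<times> long_ray) \<times> nat \<Rightarrow> ((long_ray \<times> long_ray) \<times> nat) set" where
  "pipe_proj S p = pipe_equiv S `` {p}"

lemma pipe_proj_eq_if_gluing:
  assumes "(p, q) \<in> pipe_gluing S"
  shows "pipe_proj S p = pipe_proj S q"
proof -
  have "(p, q) \<in> pipe_equiv S"
    using assms by (auto simp: pipe_equiv_def generated_equiv_def)
  then show ?thesis unfolding pipe_proj_def by (rule equiv_class_eq[OF equiv_pipe_equiv])
qed

lemma quotient_map_pipe_proj: "quotient_map (octants (length S)) (pipe S) (pipe_proj S)"
  using quotient_map_pipe by (simp add: pipe_proj_def[abs_def])

lemma topspace_pipe: "topspace (pipe S) = pipe_proj S ` (octant \<times> {1..length S})"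
  using quotient_imp_surjective_map[OF quotient_map_pipe_proj] by (simp add: topspace_octants)

text \<open>The universal property of the quotient: the kernel of \<open>\<phi>\<close> is an
  equivalence containing the gluing, hence contains \<open>pipe_equiv S\<close>.\<close>

lemma continuous_map_pipe_lift:
  assumes \<phi>: "continuous_map (octants (length S)) Y \<phi>"
    and glue: "\<And>p q. (p, q) \<in> pipe_gluing S \<Longrightarrow> \<phi> p = \<phi> q"
  obtains f where "continuous_map (pipe S) Y f"
    and "\<And>p. p \<in> octant \<times> {1..length S} \<Longrightarrow> f (pipe_proj S p) = \<phi> p"
proof -
  let ?A = "octant \<times> {1..length S}"
  define f where "f c = \<phi> (SOME p. p \<in> c)" for c
  have "equiv ?A {(p, q). p \<in> ?A \<and> q \<in> ?A \<and> \<phi> p = \<phi> q}"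
    by (rule equivI) (auto simp: refl_on_def sym_def trans_def)
  moreover have "pipe_gluing S \<subseteq> {(p, q). p \<in> ?A \<and> q \<in> ?A \<and> \<phi> p = \<phi> q}"
    using pipe_gluing_subset[of S] glue by blast
  ultimately have sub: "pipe_equiv S \<subseteq> {(p, q). p \<in> ?A \<and> q \<in> ?A \<and> \<phi> p = \<phi> q}"
    unfolding pipe_equiv_def generated_equiv_def by blast
  have f: "f (pipe_proj S p) = \<phi> p" if p: "p \<in> ?A" for p
  proof -
    have "p \<in> pipe_proj S p"
      unfolding pipe_proj_def using equiv_class_self[OF equiv_pipe_equiv] p by (simp add: topspace_octants)
    then have "(SOME q. q \<in> pipe_proj S p) \<in> pipe_proj S p" by (rule someI)
    then show ?thesis using sub by (auto simp: f_def pipe_proj_def)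
  qed
  have "continuous_map (octants (length S)) Y (f \<circ> pipe_proj S)"
    by (rule continuous_map_eq[OF \<phi>]) (simp add: topspace_octants f)
  then show ?thesis
    using that[of f] f continuous_compose_quotient_map[OF quotient_map_pipe_proj] by blast
qed

lemma continuous_map_into_octants:
  assumes "i \<in> {1..k}" "continuous_map X euclidean f" "\<And>x. x \<in> topspace X \<Longrightarrow> f x \<in> octant"
  shows "continuous_map X (octants k) (\<lambda>x. (f x, i))"
  unfolding octants_def
  by (intro continuous_map_pairedI) (use assms in \<open>auto simp: continuous_map_in_subtopology\<close>)

lemma continuous_map_from_octants:
  assumes "\<And>i. i \<in> {1..k} \<Longrightarrow> continuous_map (top_of_set octant) Y (\<lambda>p. \<phi> (p, i))"
  shows "continuous_map (octants k) Y \<phi>"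
  unfolding continuous_map_def
proof safe
  fix p i assume "(p, i) \<in> topspace (octants k)"
  then show "\<phi> (p, i) \<in> topspace Y"
    using continuous_map_funspace[OF assms[of i]] by (auto simp: topspace_octants Pi_iff)
next
  fix U assume U: "openin Y U"
  have "{p \<in> topspace (octants k). \<phi> p \<in> U} = (\<Union>i\<in>{1..k}. {p \<in> octant. \<phi> (p, i) \<in> U} \<times> {i})"
    by (auto simp: topspace_octants)
  moreover have "openin (octants k) ({p \<in> octant. \<phi> (p, i) \<in> U} \<times> {i})" if "i \<in> {1..k}" for i
    using openin_continuous_map_preimage[OF assms[OF that] U] that
    by (auto simp: octants_def openin_prod_Times_iff)
  ultimately show "openin (octants k) {p \<in> topspace (octants k). \<phi> p \<in> U}"
    by (auto intro!: openin_Union)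
qed

lemma diag_octant: "(u, u) \<in> octant" and base_octant: "(u, 0) \<in> octant"
  by (simp_all add: octant_def long_ray_zero_le)

lemma seam_in: "i \<in> {1..k} \<Longrightarrow> seam S i u \<in> octant \<times> {1..k}"
  by (auto simp: seam_def diag_octant base_octant)

lemma pipe_proj_far_side:
  "i \<in> {1..length S} \<Longrightarrow> pipe_proj S (far_side S i u) = pipe_proj S (seam S (wrap (length S) (i + 1)) u)"
  by (rule pipe_proj_eq_if_gluing[OF far_side_seam_gluing])

lemma continuous_map_pipe_proj_seam:
  assumes "i \<in> {1..length S}"
  shows "continuous_map euclidean (pipe S) (\<lambda>u. pipe_proj S (seam S i u))"
proof -
  have "continuous_map euclidean (octants (length S)) (seam S i)"
    unfolding seam_def
    by (rule continuous_map_into_octants[OF assms])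
      (cases "arr S i"; auto simp: diag_octant base_octant intro!: continuous_intros)+
  then show ?thesis
    using continuous_map_compose[OF _ quotient_imp_continuous_map[OF quotient_map_pipe_proj]]
    by (fastforce simp: o_def)
qed

section \<open>The unbounded seams of a map, and the model maps\<close>

text \<open>The maximum retracts the square onto the octant, so that results about maps on the whole
  square apply.\<close>

definition octant_map :: "arrow list \<Rightarrow> (((long_ray \<times> long_ray) \<times> nat) set \<Rightarrow> long_ray) \<Rightarrow> nat \<Rightarrow> long_ray \<times> long_ray \<Rightarrow> long_ray"
  where "octant_map S f i p = f (pipe_proj S ((max (fst p) (snd p), snd p), i))"

lemma continuous_on_octant_map:
  assumes "continuous_map (pipe S) euclidean f" "i \<in> {1..length S}"
  shows "continuous_on UNIV (octant_map S f i)"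
proof -
  have "continuous_map euclidean (octants (length S)) (\<lambda>p. ((max (fst p) (snd p), snd p), i))"
    by (rule continuous_map_into_octants[OF assms(2)])
      (auto simp: octant_def intro!: continuous_intros continuous_on_max)
  from continuous_map_compose[OF continuous_map_compose[OF this
      quotient_imp_continuous_map[OF quotient_map_pipe_proj]] assms(1)]
  show ?thesis by (simp add: o_def octant_map_def[abs_def])
qed

definition unbounded_seams :: "arrow list \<Rightarrow> (((long_ray \<times> long_ray) \<times> nat) set \<Rightarrow> long_ray) \<Rightarrow> nat set" where
  "unbounded_seams S f = {i \<in> {1..length S}. \<not> bdd_above (range (\<lambda>u. f (pipe_proj S (seam S i u))))}"

text \<open>Closure under single arrows only, which is what one octant can enforce;
  \<open>arrow_closed_eq\<close> extends it to chains.\<close>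

definition arrow_closed :: "arrow list \<Rightarrow> nat set set" where
  "arrow_closed S = {U. U \<subseteq> {1..length S} \<and> (\<forall>i\<in>{1..length S}.
     if arr S i = Up then i \<in> U \<longrightarrow> wrap (length S) (i + 1) \<in> U else wrap (length S) (i + 1) \<in> U \<longrightarrow> i \<in> U)}"

lemma wrap_Suc_in: "i \<in> {1..k} \<Longrightarrow> wrap k (i + 1) \<in> {1..k}"
  by (rule wrap_in_range) auto

text \<open>The horizontal side of octant \<open>i\<close> lies on seam \<open>i\<close> for an up
  arrow and on the next seam for a down arrow; the diagonal lies on the other one.\<close>

definition base_in :: "arrow list \<Rightarrow> nat set \<Rightarrow> nat \<Rightarrow> bool" where
  "base_in S U i \<longleftrightarrow> (if arr S i = Up then i \<in> U else wrap (length S) (i + 1) \<in> U)"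

definition diag_in :: "arrow list \<Rightarrow> nat set \<Rightarrow> nat \<Rightarrow> bool" where
  "diag_in S U i \<longleftrightarrow> (if arr S i = Up then wrap (length S) (i + 1) \<in> U else i \<in> U)"

lemma arrow_closed_iff:
  "U \<in> arrow_closed S \<longleftrightarrow> U \<subseteq> {1..length S} \<and> (\<forall>i\<in>{1..length S}. base_in S U i \<longrightarrow> diag_in S U i)"
  by (auto simp: arrow_closed_def base_in_def diag_in_def)

lemma base_in_unbounded_seams:
  assumes "i \<in> {1..length S}"
  shows "base_in S (unbounded_seams S f) i \<longleftrightarrow> \<not> bdd_above (range (\<lambda>u. octant_map S f i (u, 0)))"
    and "diag_in S (unbounded_seams S f) i \<longleftrightarrow> \<not> bdd_above (range (\<lambda>u. octant_map S f i (u, u)))"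
proof -
  have "seam S i u = ((u, if arr S i = Up then 0 else u), i)" for u by (simp add: seam_def)
  moreover have "pipe_proj S (seam S (wrap (length S) (i + 1)) u) =
      pipe_proj S ((u, if arr S i = Up then u else 0), i)" for u
    using pipe_proj_far_side[OF assms] by (simp add: far_side_def)
  ultimately show "base_in S (unbounded_seams S f) i \<longleftrightarrow> \<not> bdd_above (range (\<lambda>u. octant_map S f i (u, 0)))"
    and "diag_in S (unbounded_seams S f) i \<longleftrightarrow> \<not> bdd_above (range (\<lambda>u. octant_map S f i (u, u)))"
    using assms wrap_Suc_in[OF assms]
    by (auto simp: base_in_def diag_in_def unbounded_seams_def octant_map_def max_absorb1 long_ray_zero_le
        simp del: One_nat_def add_Suc_right)
qed

lemma unbounded_seams_closed:
  assumes "continuous_map (pipe S) euclidean f"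
  shows "unbounded_seams S f \<in> arrow_closed S"
  unfolding arrow_closed_iff
proof (intro conjI ballI impI)
  show "unbounded_seams S f \<subseteq> {1..length S}" by (auto simp: unbounded_seams_def)
  fix i assume i: "i \<in> {1..length S}" "base_in S (unbounded_seams S f) i"
  then show "diag_in S (unbounded_seams S f) i"
    using diagonal_unbounded[OF continuous_on_octant_map[OF assms i(1)]]
    by (simp add: base_in_unbounded_seams)
qed

text \<open>The homotopy along one seam is a family of maps of the ray over the unit interval. The
  other inclusion follows by reversing the homotopy.\<close>

lemma unbounded_seams_homotopic:
  assumes "homotopic_with (\<lambda>_. True) (pipe S) euclidean f g"
  shows "unbounded_seams S f \<subseteq> unbounded_seams S g"
proof
  fix i assume "i \<in> unbounded_seams S f"
  then have i: "i \<in> {1..length S}" and unb: "\<not> bdd_above (range (\<lambda>u. f (pipe_proj S (seam S i u))))"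
    by (auto simp: unbounded_seams_def)
  obtain H where H: "continuous_map (prod_topology (top_of_set {0..1::real}) (pipe S)) euclidean H"
    and ends: "\<And>p. H (0, p) = f p" "\<And>p. H (1, p) = g p"
    using assms unfolding homotopic_with_def by blast
  define h where "h q = H (snd q, pipe_proj S (seam S i (fst q)))" for q
  let ?T = "top_of_set ((UNIV :: long_ray set) \<times> {0..1::real})"
  have "continuous_map ?T (pipe S) (\<lambda>q. pipe_proj S (seam S i (fst q)))"
    using continuous_map_compose[OF _ continuous_map_pipe_proj_seam[OF i], of ?T fst]
    by (simp add: o_def continuous_on_fst)
  then have "continuous_map ?T (prod_topology (top_of_set {0..1}) (pipe S)) (\<lambda>q. (snd q, pipe_proj S (seam S i (fst q))))"
    by (intro continuous_map_pairedI) (auto simp: continuous_map_in_subtopology intro!: continuous_intros)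
  from continuous_map_compose[OF this H] have "continuous_on (UNIV \<times> {0..1}) h"
    by (simp add: o_def h_def[abs_def])
  moreover obtain D :: "real set" where "countable D" "D \<subseteq> {0..1}" "{0..1} \<subseteq> closure D"
    using separable by blast
  ultimately have "\<not> bdd_above (range (\<lambda>u. h (u, 1)))"
    by (rule unbounded_fibres_connected[where ?y0.0 = 0, OF _ connected_Icc])
      (use unb in \<open>auto simp: h_def ends\<close>)
  then show "i \<in> unbounded_seams S g"
    using i by (simp add: unbounded_seams_def h_def ends)
qed

definition model_map :: "arrow list \<Rightarrow> nat set \<Rightarrow> (long_ray \<times> long_ray) \<times> nat \<Rightarrow> long_ray" where
  "model_map S U p = (if base_in S U (snd p) then fst (fst p) else if diag_in S U (snd p) then snd (fst p) else 0)"

text \<open>The value on a side depends only on whether its seam is in \<open>U\<close>, so the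
  octants glued there agree. Closedness excludes the case of a base in \<open>U\<close> with
  diagonal outside, where \<open>x\<close> would be \<open>u\<close> instead of 0 on the
  diagonal.\<close>

lemma model_map_sides:
  assumes "U \<in> arrow_closed S" "i \<in> {1..length S}"
  shows "model_map S U (seam S i u) = (if i \<in> U then u else 0)"
    and "model_map S U (far_side S i u) = (if wrap (length S) (i + 1) \<in> U then u else 0)"
proof -
  have "base_in S U i \<longrightarrow> diag_in S U i" using assms by (simp add: arrow_closed_iff)
  then show "model_map S U (seam S i u) = (if i \<in> U then u else 0)"
    and "model_map S U (far_side S i u) = (if wrap (length S) (i + 1) \<in> U then u else 0)"
    by (auto simp: model_map_def seam_def far_side_def base_in_def diag_in_def)
qed

lemma model_map_lift:
  assumes "U \<in> arrow_closed S"
  obtains f where "continuous_map (pipe S) euclidean f"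
    and "\<And>p. p \<in> octant \<times> {1..length S} \<Longrightarrow> f (pipe_proj S p) = model_map S U p"
proof (rule continuous_map_pipe_lift[of S euclidean "model_map S U"])
  show "continuous_map (octants (length S)) euclidean (model_map S U)"
  proof (rule continuous_map_from_octants)
    show "continuous_map (top_of_set octant) euclidean (\<lambda>p. model_map S U (p, i))" for i
      by (cases "base_in S U i"; cases "diag_in S U i")
        (auto simp: model_map_def intro!: continuous_intros)
  qed
  show "model_map S U p = model_map S U q" if "(p, q) \<in> pipe_gluing S" for p q
    using pipe_gluing_sides[OF that] model_map_sides(2)[OF assms] model_map_sides(1)[OF assms wrap_Suc_in]
    by fastforce
qed (use that in blast)

lemma unbounded_seams_model_map:
  assumes U: "U \<in> arrow_closed S"
    and f: "\<And>p. p \<in> octant \<times> {1..length S} \<Longrightarrow> f (pipe_proj S p) = model_map S U p"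
  shows "unbounded_seams S f = U"
proof -
  have "f (pipe_proj S (seam S i u)) = (if i \<in> U then u else 0)" if "i \<in> {1..length S}" for i u
    using f[OF seam_in[OF that]] model_map_sides(1)[OF U that] by simp
  moreover have "\<not> bdd_above (range (\<lambda>u :: long_ray. u))"
    using long_ray_gt_ex by (auto simp: bdd_above_def) (meson leD)
  ultimately show ?thesis
    using U by (auto simp: unbounded_seams_def arrow_closed_iff cong: image_cong)
qed

text \<open>In each octant the model is \<open>x\<close>, \<open>y\<close> or \<open>0\<close>, so
  its sublevel sets lie in a square, a strip or the octant, where the bounds above apply; the
  superlevel sets are treated likewise. As there are finitely many octants, the constants can be
  made uniform.\<close>

lemma homotopic_model_map:
  assumes f: "continuous_map (pipe S) euclidean f" and g: "continuous_map (pipe S) euclidean g"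
    and g_eq: "\<And>p. p \<in> octant \<times> {1..length S} \<Longrightarrow> g (pipe_proj S p) = model_map S (unbounded_seams S f) p"
  shows "homotopic_with (\<lambda>_. True) (pipe S) euclidean f g"
proof -
  let ?U = "unbounded_seams S f"
  have f_eq: "f (pipe_proj S ((x, y), i)) = octant_map S f i (x, y)" if "y \<le> x" for x y i
    using that by (simp add: octant_map_def max_absorb1)
  have uniform: "\<exists>b. \<forall>i\<in>{1..length S}. \<beta> i < b" for \<beta> :: "nat \<Rightarrow> long_ray"
    using long_ray_gt_countable[of "\<beta> ` {1..length S}"] by auto
  have upper: "\<exists>b. \<forall>p\<in>topspace (pipe S). g p \<le> c \<longrightarrow> f p \<le> b" for c
  proof -
    have "\<exists>b. \<forall>x y. y \<le> x \<longrightarrow> model_map S ?U ((x, y), i) \<le> c \<longrightarrow> octant_map S f i (x, y) \<le> b"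
      if i: "i \<in> {1..length S}" for i
    proof -
      note h = continuous_on_octant_map[OF f i]
      consider "base_in S ?U i" | "\<not> base_in S ?U i" "diag_in S ?U i" | "\<not> base_in S ?U i" "\<not> diag_in S ?U i"
        by blast
      then show ?thesis
      proof cases
        case 1
        obtain b where "\<And>x y. x \<le> c \<Longrightarrow> y \<le> c \<Longrightarrow> octant_map S f i (x, y) \<le> b"
          using square_bounded[OF h, of c] by blast
        then show ?thesis using 1 by (intro exI[of _ b]) (auto simp: model_map_def)
      next
        case 2
        then have bd: "bdd_above (range (\<lambda>u. octant_map S f i (u, 0)))"
          using base_in_unbounded_seams(1)[OF i] by simp
        then obtain b where "\<And>x y. y \<le> c \<Longrightarrow> octant_map S f i (x, y) \<le> b"
          using fibres_bounded[OF h bd, of c] by blast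
        then show ?thesis using 2 by (intro exI[of _ b]) (auto simp: model_map_def)
      next
        case 3
        then show ?thesis using octant_bounded[OF h] base_in_unbounded_seams[OF i] by simp blast
      qed
    qed
    then obtain \<beta> where \<beta>: "\<And>i x y. i \<in> {1..length S} \<Longrightarrow> y \<le> x \<Longrightarrow> model_map S ?U ((x, y), i) \<le> c \<Longrightarrow>
        octant_map S f i (x, y) \<le> \<beta> i" by metis
    obtain b where b: "\<And>i. i \<in> {1..length S} \<Longrightarrow> \<beta> i < b" using uniform by metis
    have "f (pipe_proj S ((x, y), i)) \<le> b"
      if "i \<in> {1..length S}" "y \<le> x" "model_map S ?U ((x, y), i) \<le> c" for x y i
      using \<beta>[OF that] b[OF that(1)] f_eq[OF that(2)] by (metis less_imp_le order.trans)
    then show ?thesis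
      by (intro exI[of _ b]) (auto simp: topspace_pipe octant_def g_eq)
  qed
  have lower: "\<exists>c. \<forall>p\<in>topspace (pipe S). c \<le> g p \<longrightarrow> b \<le> f p" for b
  proof -
    have "\<exists>c. \<forall>x y. y \<le> x \<longrightarrow> c \<le> model_map S ?U ((x, y), i) \<longrightarrow> b \<le> octant_map S f i (x, y)"
      if i: "i \<in> {1..length S}" for i
    proof -
      note h = continuous_on_octant_map[OF f i]
      consider "base_in S ?U i" | "\<not> base_in S ?U i" "diag_in S ?U i" | "\<not> base_in S ?U i" "\<not> diag_in S ?U i"
        by blast
      then show ?thesis
      proof cases
        case 1
        then have bd: "\<not> bdd_above (range (\<lambda>u. octant_map S f i (u, 0)))"
          using base_in_unbounded_seams(1)[OF i] by simp
        obtain c where "\<forall>x\<ge>c. \<forall>y. b \<le> octant_map S f i (x, y)"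
          using octant_tends[OF h bd, of b] by blast
        then show ?thesis using 1 by (intro exI[of _ c]) (auto simp: model_map_def)
      next
        case 2
        then have bd: "\<not> bdd_above (range (\<lambda>u. octant_map S f i (u, u)))"
          using base_in_unbounded_seams(2)[OF i] by simp
        obtain c where "\<And>x y. c \<le> x \<Longrightarrow> c \<le> y \<Longrightarrow> b \<le> octant_map S f i (x, y)"
          using diagonal_tends[OF h bd, of b] by blast
        then show ?thesis using 2 by (intro exI[of _ c]) (auto simp: model_map_def)
      next
        case 3
        \<comment> \<open>The model vanishes here, so no point reaches a positive
          \<open>c\<close>.\<close>
        obtain c :: long_ray where "0 < c" using long_ray_gt_ex by blast
        then show ?thesis using 3 by (intro exI[of _ c]) (auto simp: model_map_def)
      qed
    qed
    then obtain \<gamma> where \<gamma>: "\<And>i x y. i \<in> {1..length S} \<Longrightarrow> y \<le> x \<Longrightarrow> \<gamma> i \<le> model_map S ?U ((x, y), i) \<Longrightarrow>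
        b \<le> octant_map S f i (x, y)" by metis
    obtain c where c: "\<And>i. i \<in> {1..length S} \<Longrightarrow> \<gamma> i < c" using uniform by metis
    have "b \<le> f (pipe_proj S ((x, y), i))"
      if "i \<in> {1..length S}" "y \<le> x" "c \<le> model_map S ?U ((x, y), i)" for x y i
      using \<gamma>[OF that(1,2)] c[OF that(1)] f_eq[OF that(2)] that(3) by (metis less_imp_le order.trans)
    then show ?thesis
      by (intro exI[of _ c]) (auto simp: topspace_pipe octant_def g_eq)
  qed
  show ?thesis by (rule homotopic_if_same_growth[OF f g upper lower])
qed

subsection \<open>Closed sets of seams and antichains\<close>

lemma arrow_closed_eq:
  "arrow_closed S = {U. U \<subseteq> {1..length S} \<and> (\<forall>i\<in>U. \<forall>j\<in>{1..length S}. arrow_less S i j \<longrightarrow> j \<in> U)}"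
  (is "_ = ?R")
proof safe
  let ?k = "length S"
  fix U assume U: "U \<in> arrow_closed S"
  then have up: "arr S i = Up \<Longrightarrow> i \<in> U \<Longrightarrow> wrap ?k (i + 1) \<in> U"
    and down: "arr S i = Down \<Longrightarrow> wrap ?k (i + 1) \<in> U \<Longrightarrow> i \<in> U" if "i \<in> {1..?k}" for i
    using that by (auto simp: arrow_closed_def split: if_splits)
  show sub: "x \<in> {1..?k}" if "x \<in> U" for x using U that by (auto simp: arrow_closed_def)
  fix i j assume ij: "i \<in> U" "j \<in> {1..?k}" "arrow_less S i j"
  have in_range: "wrap ?k (n + l) \<in> {1..?k}" if "n \<in> {1..?k}" for n l
    by (rule wrap_in_range) (use that in auto)
  have arr_eq: "arr S (wrap ?k (n + l)) = arr S (n + l)" "wrap ?k (wrap ?k (n + l) + 1) = wrap ?k (n + Suc l)"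
    if "n \<in> {1..?k}" for n l
    using that arr_wrap[of "n + l" S] wrap_add[of "n + l" ?k 1] by auto
  have "wrap ?k (i + l) \<in> U" if "\<forall>m<l. arr S (i + m) = Up" for l
    using that
  proof (induction l)
    case 0
    then show ?case using ij(1) sub wrap_id by simp
  next
    case (Suc l)
    have "arr S (wrap ?k (i + l)) = Up"
      using arr_eq(1)[OF sub[OF ij(1)]] Suc.prems by simp
    moreover have "wrap ?k (i + l) \<in> U" using Suc by simp
    ultimately have "wrap ?k (wrap ?k (i + l) + 1) \<in> U"
      by (rule up[OF in_range[OF sub[OF ij(1)]]])
    then show ?case unfolding arr_eq(2)[OF sub[OF ij(1)]] .
  qed
  \<comment> \<open>For down arrows the chain starts at the larger index \<open>j + l\<close>, so
    the induction walks backwards to \<open>j\<close>.\<close>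
  moreover have "j \<in> U" if "wrap ?k (j + l) \<in> U" "\<forall>m<l. arr S (j + m) = Down" for l
    using that
  proof (induction l)
    case 0
    then show ?case using ij(2) wrap_id by simp
  next
    case (Suc l)
    have "arr S (wrap ?k (j + l)) = Down"
      using arr_eq(1)[OF ij(2)] Suc.prems by simp
    moreover have "wrap ?k (wrap ?k (j + l) + 1) \<in> U"
      unfolding arr_eq(2)[OF ij(2)] by (rule Suc.prems(1))
    ultimately have "wrap ?k (j + l) \<in> U"
      by (rule down[OF in_range[OF ij(2)]])
    then show ?case using Suc by simp
  qed
  ultimately show "j \<in> U" using ij unfolding arrow_less_def by blast
next
  let ?k = "length S"
  fix U assume U: "U \<subseteq> {1..?k}" "\<forall>i\<in>U. \<forall>j\<in>{1..?k}. arrow_less S i j \<longrightarrow> j \<in> U"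
  have "if arr S i = Up then arrow_less S i (wrap ?k (i + 1)) else arrow_less S (wrap ?k (i + 1)) i"
    if "i \<in> {1..?k}" for i
    using that by (cases "arr S i") (auto simp: arrow_less_def intro!: bexI[of _ 1])
  then show "U \<in> arrow_closed S"
    using U wrap_Suc_in by (fastforce simp: arrow_closed_def simp del: add_Suc_right One_nat_def split: if_splits)
qed

text \<open>In a finite strict order every element of an up-closed set lies above a minimal one, so
  the set is recovered from its minimal elements.\<close>

lemma bij_betw_minimal_elements:
  assumes A: "finite A" and irrefl: "\<And>x. x \<in> A \<Longrightarrow> (x, x) \<notin> r"
    and trans: "\<And>x y z. x \<in> A \<Longrightarrow> y \<in> A \<Longrightarrow> z \<in> A \<Longrightarrow> (x, y) \<in> r \<Longrightarrow> (y, z) \<in> r \<Longrightarrow> (x, z) \<in> r"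
  shows "bij_betw (\<lambda>U. {x \<in> U. \<forall>y\<in>U. (y, x) \<notin> r})
    {U. U \<subseteq> A \<and> (\<forall>x\<in>U. \<forall>y\<in>A. (x, y) \<in> r \<longrightarrow> y \<in> U)} (antichains A r)"
proof (rule bij_betw_byWitness[where f' = "\<lambda>B. {x \<in> A. \<exists>b\<in>B. b = x \<or> (b, x) \<in> r}"])
  \<comment> \<open>Restricted to \<open>A\<close>, since irreflexivity and transitivity of
    \<open>r\<close> are known only there.\<close>
  let ?s = "r \<inter> A \<times> A"
  have "trans ?s" by (rule transI) (use trans in blast)
  then have "acyclic ?s" using irrefl by (auto simp: acyclic_def)
  then have wf: "wf ?s" using A by (intro finite_acyclic_wf) auto
  have minimal_below: "\<exists>b\<in>U. (\<forall>y\<in>U. (y, b) \<notin> r) \<and> (b = x \<or> (b, x) \<in> r)" if U: "U \<subseteq> A" "x \<in> U" for U x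
  proof -
    have x: "x \<in> {y \<in> U. y = x \<or> (y, x) \<in> r}" using U by simp
    obtain z where z: "z \<in> {y \<in> U. y = x \<or> (y, x) \<in> r}"
      and min: "\<And>y. (y, z) \<in> ?s \<Longrightarrow> y \<notin> {y \<in> U. y = x \<or> (y, x) \<in> r}"
      by (rule wfE_min[OF wf x], rule that)
    have "(y, z) \<notin> r" if y: "y \<in> U" for y
    proof
      assume yz: "(y, z) \<in> r"
      have "y \<in> A" "z \<in> A" "x \<in> A" using y z U by auto
      then have "(y, x) \<in> r" using trans[of y z x] yz z by auto
      then show False using min[of y] yz y \<open>y \<in> A\<close> \<open>z \<in> A\<close> by simp
    qed
    then show ?thesis using z by blast
  qed
  show "\<forall>U\<in>{U. U \<subseteq> A \<and> (\<forall>x\<in>U. \<forall>y\<in>A. (x, y) \<in> r \<longrightarrow> y \<in> U)}.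
      {x \<in> A. \<exists>b\<in>{x \<in> U. \<forall>y\<in>U. (y, x) \<notin> r}. b = x \<or> (b, x) \<in> r} = U"
  proof
    fix U assume "U \<in> {U. U \<subseteq> A \<and> (\<forall>x\<in>U. \<forall>y\<in>A. (x, y) \<in> r \<longrightarrow> y \<in> U)}"
    then have U: "U \<subseteq> A" and up: "\<And>x y. x \<in> U \<Longrightarrow> y \<in> A \<Longrightarrow> (x, y) \<in> r \<Longrightarrow> y \<in> U" by auto
    show "{x \<in> A. \<exists>b\<in>{x \<in> U. \<forall>y\<in>U. (y, x) \<notin> r}. b = x \<or> (b, x) \<in> r} = U"
    proof (intro equalityI subsetI)
      fix x assume "x \<in> U"
      then show "x \<in> {x \<in> A. \<exists>b\<in>{x \<in> U. \<forall>y\<in>U. (y, x) \<notin> r}. b = x \<or> (b, x) \<in> r}"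
        using minimal_below[OF U, of x] U by auto
    qed (use up in auto)
  qed
  show "\<forall>B\<in>antichains A r. {x \<in> {x \<in> A. \<exists>b\<in>B. b = x \<or> (b, x) \<in> r}.
      \<forall>y\<in>{x \<in> A. \<exists>b\<in>B. b = x \<or> (b, x) \<in> r}. (y, x) \<notin> r} = B"
  proof
    fix B assume "B \<in> antichains A r"
    then have BA: "B \<subseteq> A" and pw: "pairwise (\<lambda>x y. (x, y) \<notin> r \<and> (y, x) \<notin> r) B"
      by (auto simp: antichains_def)
    have B: "(x, y) \<notin> r" if "x \<in> B" "y \<in> B" for x y
      using pairwiseD[OF pw that] irrefl[of x] BA that by (cases "x = y") auto
    show "{x \<in> {x \<in> A. \<exists>b\<in>B. b = x \<or> (b, x) \<in> r}.
      \<forall>y\<in>{x \<in> A. \<exists>b\<in>B. b = x \<or> (b, x) \<in> r}. (y, x) \<notin> r} = B" (is "?M = B")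
    proof (intro equalityI subsetI)
      fix x assume x: "x \<in> ?M"
      then obtain b where b: "b \<in> B" "b = x \<or> (b, x) \<in> r" by auto
      then show "x \<in> B" using x BA by blast
    next
      fix x assume x: "x \<in> B"
      have "(y, x) \<notin> r" if y: "y \<in> A" "b \<in> B" "b = y \<or> (b, y) \<in> r" for y b
        using B[OF y(2) x] trans[of b y x] BA x y by auto
      then show "x \<in> ?M" using x BA by auto
    qed
  qed
  show "(\<lambda>U. {x \<in> U. \<forall>y\<in>U. (y, x) \<notin> r}) ` {U. U \<subseteq> A \<and> (\<forall>x\<in>U. \<forall>y\<in>A. (x, y) \<in> r \<longrightarrow> y \<in> U)}
    \<subseteq> antichains A r"
    by (auto simp: antichains_def pairwise_def)
  show "(\<lambda>B. {x \<in> A. \<exists>b\<in>B. b = x \<or> (b, x) \<in> r}) ` antichains A r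
    \<subseteq> {U. U \<subseteq> A \<and> (\<forall>x\<in>U. \<forall>y\<in>A. (x, y) \<in> r \<longrightarrow> y \<in> U)}"
  proof
    fix U assume "U \<in> (\<lambda>B. {x \<in> A. \<exists>b\<in>B. b = x \<or> (b, x) \<in> r}) ` antichains A r"
    then obtain B where B: "B \<subseteq> A" and U: "U = {x \<in> A. \<exists>b\<in>B. b = x \<or> (b, x) \<in> r}"
      by (auto simp: antichains_def)
    have "y \<in> U" if x: "x \<in> U" and y: "y \<in> A" "(x, y) \<in> r" for x y
    proof -
      obtain b where b: "b \<in> B" "b = x \<or> (b, x) \<in> r" "x \<in> A" using x U by auto
      then have "(b, y) \<in> r" using trans[of b x y] B y by auto
      then show ?thesis using U b(1) y(1) by blast
    qed
    then show "U \<in> {U. U \<subseteq> A \<and> (\<forall>x\<in>U. \<forall>y\<in>A. (x, y) \<in> r \<longrightarrow> y \<in> U)}"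
      using U by blast
  qed
qed

text \<open>For constant \<open>S\<close> every seam precedes itself, so minimal elements are of no
  use; instead, both families are seen to have two members.\<close>

lemma arrow_closed_antichains:
  assumes "S \<noteq> []"
  shows "\<exists>F. bij_betw F (arrow_closed S) (antichains (arrow_poset S) (arrow_poset_less S))"
proof (cases "Up \<in> set S \<and> Down \<in> set S")
  case True
  then have Up: "Up \<in> set S" and Down: "Down \<in> set S" by auto
  let ?r = "{(i, j). arrow_less S i j}"
  have "arrow_closed S = {U. U \<subseteq> {1..length S} \<and> (\<forall>i\<in>U. \<forall>j\<in>{1..length S}. (i, j) \<in> ?r \<longrightarrow> j \<in> U)}"
    by (simp add: arrow_closed_eq)
  moreover have "bij_betw (\<lambda>U. {x \<in> U. \<forall>y\<in>U. (y, x) \<notin> ?r})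
      {U. U \<subseteq> {1..length S} \<and> (\<forall>i\<in>U. \<forall>j\<in>{1..length S}. (i, j) \<in> ?r \<longrightarrow> j \<in> U)} (antichains {1..length S} ?r)"
  proof (rule bij_betw_minimal_elements)
    show "(x, z) \<in> ?r" if "x \<in> {1..length S}" "y \<in> {1..length S}" "z \<in> {1..length S}" "(x, y) \<in> ?r" "(y, z) \<in> ?r" for x y z
      using arrow_less_strict_order(2)[OF Up Down that(1-3)] that(4,5) by simp
  qed (use arrow_less_strict_order(1)[OF Up Down] in simp_all)
  ultimately have "bij_betw (\<lambda>U. {x \<in> U. \<forall>y\<in>U. (y, x) \<notin> ?r}) (arrow_closed S) (antichains {1..length S} ?r)"
    by (simp only:)
  from bij_betw_trans[OF this antichains_arrow_poset[OF Up Down]] show ?thesis by blast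
next
  case False
  then obtain a where a: "set S \<subseteq> {a}"
    by (metis (full_types) arrow.exhaust singleton_iff subsetI)
  have ne: "{1..length S} \<noteq> {}" using assms by (cases S) auto
  have closed: "arrow_closed S = {{}, {1..length S}}"
    unfolding arrow_closed_eq using arrow_less_if_constant[OF a] by blast
  have "antichains (arrow_poset S) (arrow_poset_less S) = Pow {{1..length S}}"
    unfolding arrow_poset_constant[OF a assms]
    by (auto simp: antichains_def arrow_poset_less_def arrow_poset_constant[OF a assms] pairwise_def)
  then show ?thesis
    using ne closed by (intro finite_same_card_bij) (auto simp: card_Pow)
qed

lemma bij_betw_quotient_fibres:
  assumes R: "equiv A R" and F: "\<And>x y. x \<in> A \<Longrightarrow> y \<in> A \<Longrightarrow> (x, y) \<in> R \<longleftrightarrow> F x = F y"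
  shows "bij_betw (\<lambda>v. {x \<in> A. F x = v}) (F ` A) (A // R)"
proof -
  have "R `` {x} = {y \<in> A. F y = F x}" if "x \<in> A" for x
    using F[OF that] equiv_type[OF R] by (auto dest: sym)
  then have "(\<lambda>v. {x \<in> A. F x = v}) ` F ` A = A // R"
    by (auto simp: quotient_def image_image)
  then show ?thesis by (auto simp: bij_betw_def inj_on_def)
qed

theorem theorem4:
  fixes k :: nat and S :: "arrow list"
  assumes "k \<ge> 1" and "length S = k"
  shows "\<exists>F. bij_betw F
           (homotopy_classes (pipe S) (euclidean :: long_ray topology))
           (antichains (arrow_poset S) (arrow_poset_less S))"
proof -
  let ?C = "{f. continuous_map (pipe S) (euclidean :: long_ray topology) f}"
  let ?R = "{(f, g). homotopic_with (\<lambda>_. True) (pipe S) (euclidean :: long_ray topology) f g}"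
  have classify: "(f, g) \<in> ?R \<longleftrightarrow> unbounded_seams S f = unbounded_seams S g" if f: "f \<in> ?C" and g: "g \<in> ?C" for f g
  proof
    assume "(f, g) \<in> ?R"
    then show "unbounded_seams S f = unbounded_seams S g"
      using unbounded_seams_homotopic[of S f g] unbounded_seams_homotopic[of S g f] homotopic_with_sym by blast
  next
    assume eq: "unbounded_seams S f = unbounded_seams S g"
    \<comment> \<open>Both maps are compared with the same model rather than with each other, since
      growth was only estimated against models.\<close>
    obtain m where "continuous_map (pipe S) euclidean m"
      "\<And>p. p \<in> octant \<times> {1..length S} \<Longrightarrow> m (pipe_proj S p) = model_map S (unbounded_seams S f) p"
      using model_map_lift[OF unbounded_seams_closed[of S f]] f by blast
    then have "homotopic_with (\<lambda>_. True) (pipe S) euclidean f m"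
      "homotopic_with (\<lambda>_. True) (pipe S) euclidean g m"
      using f g eq homotopic_model_map[of S f m] homotopic_model_map[of S g m] by auto
    then show "(f, g) \<in> ?R"
      using homotopic_with_trans homotopic_with_sym by blast
  qed
  have "unbounded_seams S ` ?C = arrow_closed S"
  proof safe
    show "U \<in> unbounded_seams S ` ?C" if U: "U \<in> arrow_closed S" for U
    proof -
      obtain f where "continuous_map (pipe S) euclidean f"
        "\<And>p. p \<in> octant \<times> {1..length S} \<Longrightarrow> f (pipe_proj S p) = model_map S U p"
        using model_map_lift[OF U] by blast
      then show ?thesis using unbounded_seams_model_map[OF U] by blast
    qed
  qed (rule unbounded_seams_closed)
  then have "bij_betw (\<lambda>U. {f \<in> ?C. unbounded_seams S f = U}) (arrow_closed S)
      (homotopy_classes (pipe S) (euclidean :: long_ray topology))"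
    using bij_betw_quotient_fibres[OF equiv_homotopic classify] by (simp add: homotopy_classes_def)
  then obtain G where G: "bij_betw G (homotopy_classes (pipe S) (euclidean :: long_ray topology)) (arrow_closed S)"
    using bij_betw_inv by blast
  have "S \<noteq> []" using assms by auto
  then obtain F where "bij_betw F (arrow_closed S) (antichains (arrow_poset S) (arrow_poset_less S))"
    using arrow_closed_antichains by blast
  from bij_betw_trans[OF G this] show ?thesis by blast
qed

end
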